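(* A (real) vector lattice $E$ is Noetherian if and only if it is lattice isomorphic to a vector sublattice of $\mathbb R^X_{\mathrm{lex}}$ containing $\mathrm{Lex}(X)$, for some well-founded forest $X$ with finite width.
   Context: An (order) ideal of a vector lattice $E$ is a linear subspace $I$ such that $|x|\le|y|$, $x\in E$, $y\in I$ imply $x\in I$. $E$ is Noetherian if every increasing sequence $(I_n)_{n\in\mathbb N}$ of ideals of $E$ is stationary (there is $k$ with $I_n=I_k$ for all $n\ge k$). A poset $X$ is well-founded if every nonempty subset of $X$ has a minimal element. $X$ is a forest if $\{y\in X: y\le x\}$ is totally ordered for every $x\in X$. $X$ has finite width if every antichain (set of pairwise incomparable elements) in $X$ is finite. For a poset $X$, $\mathbb R^X_{\mathrm{lex}}$ is the vector space of all functions $f:X\to\mathbb R$ whose support $\mathrm{supp}(f)=\{x: f(x)\neq 0\}$ is well-founded, ordered by the cone of those $f$ such that $f(x)>0$ for every minimal element $x$ of $\mathrm{supp}(f)$. If $X$ is a forest, $\mathbb R^X_{\mathrm{lex}}$ is a vector lattice, and $\mathrm{Lex}(X)$ denotes its sublattice of all finitely supported functions. *)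

theory Defs
  imports Complex_Main
begin

(* A real vector lattice is a type of sort {ordered_real_vector, lattice}: a real vector space
   with a translation- and scaling-invariant partial order that is a lattice. *)

definition modulus :: "'a::{ordered_real_vector, lattice} \<Rightarrow> 'a" where
  "modulus x = sup x (- x)"

definition order_ideal :: "'a::{ordered_real_vector, lattice} set \<Rightarrow> bool" where
  "order_ideal I \<longleftrightarrow>
     subspace I \<and> (\<forall>x y. modulus x \<le> modulus y \<longrightarrow> y \<in> I \<longrightarrow> x \<in> I)"

definition noetherian :: "'a::{ordered_real_vector, lattice} itself \<Rightarrow> bool" where
  "noetherian (_ :: 'a itself) \<longleftrightarrow>
     (\<forall>I :: nat \<Rightarrow> 'a set. (\<forall>n. order_ideal (I n)) \<and> incseq I
        \<longrightarrow> (\<exists>k. \<forall>n\<ge>k. I n = I k))"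


(* A poset is a carrier set X with a reflexive relation r such that partial_order_on X r;
   (x, y) \<in> r reads x \<le> y. Subsets of X carry the induced order. *)

definition minimal_elements :: "('b \<times> 'b) set \<Rightarrow> 'b set \<Rightarrow> 'b set" where
  "minimal_elements r S = {m \<in> S. \<forall>y\<in>S. (y, m) \<in> r \<longrightarrow> y = m}"

definition well_founded_poset :: "('b \<times> 'b) set \<Rightarrow> 'b set \<Rightarrow> bool" where
  "well_founded_poset r X \<longleftrightarrow> (\<forall>S\<subseteq>X. S \<noteq> {} \<longrightarrow> minimal_elements r S \<noteq> {})"

definition forest_poset :: "('b \<times> 'b) set \<Rightarrow> 'b set \<Rightarrow> bool" where
  "forest_poset r X \<longleftrightarrow> (\<forall>x\<in>X. total_on {y \<in> X. (y, x) \<in> r} r)"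

definition finite_width :: "('b \<times> 'b) set \<Rightarrow> 'b set \<Rightarrow> bool" where
  "finite_width r X \<longleftrightarrow>
     (\<forall>A\<subseteq>X. pairwise (\<lambda>x y. (x, y) \<notin> r \<and> (y, x) \<notin> r) A \<longrightarrow> finite A)"


definition supp :: "('b \<Rightarrow> real) \<Rightarrow> 'b set" where
  "supp f = {x. f x \<noteq> 0}"

(* Functions on the carrier X are represented by their extension by zero to the whole type,
   hence the condition supp f \<subseteq> X; the vector space operations are pointwise. *)

definition lex_space :: "('b \<times> 'b) set \<Rightarrow> 'b set \<Rightarrow> ('b \<Rightarrow> real) set" where
  "lex_space r X = {f. supp f \<subseteq> X \<and> well_founded_poset r (supp f)}"

definition lex_cone :: "('b \<times> 'b) set \<Rightarrow> 'b set \<Rightarrow> ('b \<Rightarrow> real) set" where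
  "lex_cone r X = {f \<in> lex_space r X. \<forall>x\<in>minimal_elements r (supp f). f x > 0}"

definition lex_le :: "('b \<times> 'b) set \<Rightarrow> 'b set \<Rightarrow> ('b \<Rightarrow> real) \<Rightarrow> ('b \<Rightarrow> real) \<Rightarrow> bool" where
  "lex_le r X f g \<longleftrightarrow> (\<lambda>x. g x - f x) \<in> lex_cone r X"

(* Since lex_space r X is a lattice only for suitable posets, suprema and infima of two elements,
   taken in the whole of lex_space r X, are expressed relationally. *)

definition is_lex_sup ::
  "('b \<times> 'b) set \<Rightarrow> 'b set \<Rightarrow> ('b \<Rightarrow> real) \<Rightarrow> ('b \<Rightarrow> real) \<Rightarrow> ('b \<Rightarrow> real) \<Rightarrow> bool" where
  "is_lex_sup r X f g h \<longleftrightarrow>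
     h \<in> lex_space r X \<and> lex_le r X f h \<and> lex_le r X g h \<and>
     (\<forall>k\<in>lex_space r X. lex_le r X f k \<and> lex_le r X g k \<longrightarrow> lex_le r X h k)"

definition is_lex_inf ::
  "('b \<times> 'b) set \<Rightarrow> 'b set \<Rightarrow> ('b \<Rightarrow> real) \<Rightarrow> ('b \<Rightarrow> real) \<Rightarrow> ('b \<Rightarrow> real) \<Rightarrow> bool" where
  "is_lex_inf r X f g h \<longleftrightarrow>
     h \<in> lex_space r X \<and> lex_le r X h f \<and> lex_le r X h g \<and>
     (\<forall>k\<in>lex_space r X. lex_le r X k f \<and> lex_le r X k g \<longrightarrow> lex_le r X k h)"

definition Lex :: "('b \<times> 'b) set \<Rightarrow> 'b set \<Rightarrow> ('b \<Rightarrow> real) set" where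
  "Lex r X = {f \<in> lex_space r X. finite (supp f)}"

definition vector_sublattice :: "('b \<times> 'b) set \<Rightarrow> 'b set \<Rightarrow> ('b \<Rightarrow> real) set \<Rightarrow> bool" where
  "vector_sublattice r X F \<longleftrightarrow>
     F \<subseteq> lex_space r X \<and>
     (\<lambda>_. 0) \<in> F \<and>
     (\<forall>f\<in>F. \<forall>g\<in>F. (\<lambda>x. f x + g x) \<in> F) \<and>
     (\<forall>c. \<forall>f\<in>F. (\<lambda>x. c * f x) \<in> F) \<and>
     (\<forall>f\<in>F. \<forall>g\<in>F. \<exists>h\<in>F. is_lex_sup r X f g h) \<and>
     (\<forall>f\<in>F. \<forall>g\<in>F. \<exists>h\<in>F. is_lex_inf r X f g h)"

definition lattice_isomorphism ::
  "('b \<times> 'b) set \<Rightarrow> 'b set \<Rightarrow> ('b \<Rightarrow> real) set \<Rightarrow>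
   ('a::{ordered_real_vector, lattice} \<Rightarrow> 'b \<Rightarrow> real) \<Rightarrow> bool" where
  "lattice_isomorphism r X F T \<longleftrightarrow>
     bij_betw T UNIV F \<and>
     (\<forall>u v. T (u + v) = (\<lambda>x. T u x + T v x)) \<and>
     (\<forall>c u. T (c *\<^sub>R u) = (\<lambda>x. c * T u x)) \<and>
     (\<forall>u v. is_lex_sup r X (T u) (T v) (T (sup u v))) \<and>
     (\<forall>u v. is_lex_inf r X (T u) (T v) (T (inf u v)))"

definition lex_representable ::
  "'a::{ordered_real_vector, lattice} itself \<Rightarrow> ('b \<times> 'b) set \<Rightarrow> 'b set \<Rightarrow> bool" where
  "lex_representable (_ :: 'a itself) r X \<longleftrightarrow>
     (\<exists>F (T :: 'a \<Rightarrow> 'b \<Rightarrow> real).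
        vector_sublattice r X F \<and> Lex r X \<subseteq> F \<and> lattice_isomorphism r X F T)"

definition wf_forest_of_finite_width :: "('b \<times> 'b) set \<Rightarrow> 'b set \<Rightarrow> bool" where
  "wf_forest_of_finite_width r X \<longleftrightarrow>
     partial_order_on X r \<and> well_founded_poset r X \<and> forest_poset r X \<and> finite_width r X"

(* In the theorem the existentially quantified poset lives on a subset of the vector
   lattice E itself. This is no restriction: if E is isomorphic to a sublattice containing Lex r X,
   the indicator functions of the points of X yield an injection of X into E. The theorem
   also states sufficiency for posets over an arbitrary type 'b. *)

end

theory Submission
  imports Defs
begin

text \<open>
  If the lattice sits between \<^term>\<open>Lex r X\<close> and the whole function space, an ideal is determined by
  the upper set of those points whose indicator function it contains. An upper set of a well-founded
  poset of finite width is generated by finitely many minimal points, so increasing sequences of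
  ideals are stationary.

  Conversely, in a Noetherian vector lattice every nonzero element has a value: an ideal maximal
  among those not containing it. These regular ideals are prime, so under reversed inclusion
  they form a forest; it is well-founded by the chain condition, which also excludes infinite
  antichains. Each regular ideal \<open>P\<close> has a positive element \<open>e\<^sub>P\<close> outside it that lies in all regular
  ideals not contained in \<open>P\<close>. As the \<open>e\<^sub>Q\<close> with \<open>Q \<supseteq> P\<close> are linearly independent modulo \<open>P\<close>, there is a
  linear functional that vanishes on \<open>P\<close> and on all \<open>e\<^sub>Q\<close> with \<open>Q \<noteq> P\<close> and takes the value 1 at \<open>e\<^sub>P\<close>.
  These functionals are the coordinates of the embedding. Supports are automatically well-founded, so
  the choice of the functionals is otherwise arbitrary, and the coherent choice of complements of the
  general Hahn embedding theorem is not needed.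
\<close>

section \<open>Ideals of vector lattices\<close>

lemma inf_add_right: "inf (b + a) (c + a) = inf b c + a"
  for a b c :: "'a::{ordered_real_vector, lattice}"
proof (rule antisym)
  have "inf (b + a) (c + a) - a \<le> inf b c"
    by (intro le_infI) (simp_all add: diff_le_eq)
  from add_right_mono[OF this, of a] show "inf (b + a) (c + a) \<le> inf b c + a"
    by (simp del: add_le_cancel_right)
qed simp

lemma sup_add_right: "sup (b + a) (c + a) = sup b c + a"
  for a b c :: "'a::{ordered_real_vector, lattice}"
proof (rule antisym)
  have "sup b c \<le> sup (b + a) (c + a) - a"
    by (intro le_supI) (simp_all add: le_diff_eq)
  from add_right_mono[OF this, of a] show "sup b c + a \<le> sup (b + a) (c + a)"
    by (simp del: add_le_cancel_right)
qed simp

text \<open>The reflection of \<open>z\<close> to \<open>a + b - z\<close> reverses the order and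
  swaps \<open>a\<close> and \<open>b\<close>, so it exchanges their upper and lower bounds.\<close>

lemma sup_add_inf: "sup a b + inf a b = a + b"
  for a b :: "'a::{ordered_real_vector, lattice}"
proof (rule antisym)
  have "a + b - inf a b \<ge> a" "a + b - inf a b \<ge> b"
    by (simp_all add: le_diff_eq add.commute)
  then have "sup a b \<le> a + b - inf a b"
    by simp
  then show "sup a b + inf a b \<le> a + b"
    by (simp add: le_diff_eq)
  have "a + b - sup a b \<le> a" "a + b - sup a b \<le> b"
    by (simp_all add: diff_le_eq add.commute)
  then have "a + b - sup a b \<le> inf a b"
    by simp
  then show "a + b \<le> sup a b + inf a b"
    by (metis diff_le_eq add.commute)
qed

text \<open>Subtracting the infimum makes any two elements disjoint. In this way primality, which
  speaks of disjoint pairs only, is applied to arbitrary pairs.\<close>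

lemma inf_diff_inf_eq_0: "inf (a - inf a b) (b - inf a b) = 0"
  for a b :: "'a::{ordered_real_vector, lattice}"
  using inf_add_right[of a "- inf a b" b] by simp

lemma scaleR_inf: "0 \<le> t \<Longrightarrow> t *\<^sub>R inf a b = inf (t *\<^sub>R a) (t *\<^sub>R b)"
  for a b :: "'a::{ordered_real_vector, lattice}"
proof (cases "t = 0")
  case False
  assume "0 \<le> t"
  with False have t: "0 < t" by simp
  show ?thesis
  proof (rule antisym)
    show "t *\<^sub>R inf a b \<le> inf (t *\<^sub>R a) (t *\<^sub>R b)"
      using t by (simp add: scaleR_left_mono)
    have "inverse t *\<^sub>R inf (t *\<^sub>R a) (t *\<^sub>R b) \<le> a"
      using scaleR_left_mono[of "inf (t *\<^sub>R a) (t *\<^sub>R b)" "t *\<^sub>R a" "inverse t"] t by simp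
    moreover have "inverse t *\<^sub>R inf (t *\<^sub>R a) (t *\<^sub>R b) \<le> b"
      using scaleR_left_mono[of "inf (t *\<^sub>R a) (t *\<^sub>R b)" "t *\<^sub>R b" "inverse t"] t by simp
    ultimately have "inverse t *\<^sub>R inf (t *\<^sub>R a) (t *\<^sub>R b) \<le> inf a b"
      by simp
    then have "t *\<^sub>R (inverse t *\<^sub>R inf (t *\<^sub>R a) (t *\<^sub>R b)) \<le> t *\<^sub>R inf a b"
      using t by (intro scaleR_left_mono) auto
    then show "inf (t *\<^sub>R a) (t *\<^sub>R b) \<le> t *\<^sub>R inf a b"
      using t by simp
  qed
qed simp

lemma le_modulus: "x \<le> modulus x" "- x \<le> modulus x"
  by (simp_all add: modulus_def)

lemma modulus_le_iff: "modulus x \<le> y \<longleftrightarrow> x \<le> y \<and> - x \<le> y"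
  by (simp add: modulus_def)

lemma nonneg_if_ge_both:
  fixes x y :: "'a::ordered_real_vector"
  assumes "x \<le> y" "- x \<le> y"
  shows "0 \<le> y"
proof -
  have "0 \<le> y + y"
    using add_mono[OF assms] by simp
  then have "0 \<le> (1/2) *\<^sub>R (y + y)"
    by (intro scaleR_nonneg_nonneg) auto
  then show ?thesis
    by (simp add: scaleR_2[symmetric])
qed

lemma modulus_nonneg: "0 \<le> modulus x"
  using nonneg_if_ge_both le_modulus by blast

lemma modulus_of_nonneg: "0 \<le> x \<Longrightarrow> modulus x = x"
  by (rule antisym) (simp_all add: modulus_le_iff le_modulus order_trans[of "- x" 0 x])

lemma modulus_modulus: "modulus (modulus x) = modulus x"
  by (simp add: modulus_of_nonneg modulus_nonneg)

lemma idealD: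
  assumes "order_ideal I"
  shows ideal_0: "0 \<in> I"
    and ideal_add: "x \<in> I \<Longrightarrow> y \<in> I \<Longrightarrow> x + y \<in> I"
    and ideal_diff: "x \<in> I \<Longrightarrow> y \<in> I \<Longrightarrow> x - y \<in> I"
    and ideal_scaleR: "x \<in> I \<Longrightarrow> c *\<^sub>R x \<in> I"
  using assms unfolding order_ideal_def
  by (auto intro: subspace_0 subspace_add subspace_diff subspace_scale)

lemma ideal_scaleR_iff:
  assumes "order_ideal I" "c \<noteq> 0"
  shows "c *\<^sub>R x \<in> I \<longleftrightarrow> x \<in> I"
  using ideal_scaleR[OF assms(1), of "c *\<^sub>R x" "inverse c"] ideal_scaleR[OF assms(1), of x c] assms(2)
  by auto

lemma mem_ideal_if_le:
  assumes "order_ideal I" "p \<in> I" "x \<le> p" "- x \<le> p"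
  shows "x \<in> I"
  using assms order_trans[of "modulus x" p "modulus p"]
  unfolding order_ideal_def by (auto simp: modulus_le_iff le_modulus)

lemma mem_ideal_if_nonneg_le:
  assumes "order_ideal I" "p \<in> I" "0 \<le> x" "x \<le> p"
  shows "x \<in> I"
  using assms(3,4) by (intro mem_ideal_if_le[OF assms(1,2)]) (auto intro: order_trans[of "- x" 0 p])

lemma modulus_mem_ideal_iff:
  assumes "order_ideal I"
  shows "modulus x \<in> I \<longleftrightarrow> x \<in> I"
  using assms unfolding order_ideal_def by (metis modulus_modulus order_refl)

lemma order_idealI:
  assumes "subspace I" "\<And>x p. p \<in> I \<Longrightarrow> x \<le> modulus p \<Longrightarrow> - x \<le> modulus p \<Longrightarrow> x \<in> I"
  shows "order_ideal I"
  using assms unfolding order_ideal_def by (auto simp: modulus_le_iff)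

lemma order_ideal_Inter:
  assumes "\<And>P. P \<in> N \<Longrightarrow> order_ideal P"
  shows "order_ideal (\<Inter>N)"
  using assms unfolding order_ideal_def subspace_def by blast

text \<open>An ideal contains an element exactly when it contains its modulus, so positive elements
  suffice to separate ideals.\<close>

lemma not_subset_nonneg:
  assumes "order_ideal I" "order_ideal J" "\<not> I \<subseteq> J"
  obtains a where "0 \<le> a" "a \<in> I" "a \<notin> J"
  using assms modulus_mem_ideal_iff modulus_nonneg by (metis subsetI)

text \<open>For an ideal \<open>I\<close> and \<open>0 \<le> a\<close> this is the ideal generated
  by \<open>I\<close> and \<open>a\<close>. Membership is phrased by one majorant of both
  \<open>x\<close> and \<open>- x\<close>, so that bounds can be added and scaled without computing
  moduli.\<close>

definition adjoin :: "'a::{ordered_real_vector, lattice} set \<Rightarrow> 'a \<Rightarrow> 'a set" where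
  "adjoin I a = {x. \<exists>p\<in>I. \<exists>t\<ge>0. x \<le> p + t *\<^sub>R a \<and> - x \<le> p + t *\<^sub>R a}"

lemma order_ideal_adjoin:
  assumes I: "order_ideal I"
  shows "order_ideal (adjoin I a)"
proof (rule order_idealI)
  show "subspace (adjoin I a)"
  proof (rule subspaceI)
    show "0 \<in> adjoin I a"
      using ideal_0[OF I] by (force simp: adjoin_def)
  next
    fix x y assume "x \<in> adjoin I a" "y \<in> adjoin I a"
    then obtain p t q s where *: "p \<in> I" "0 \<le> t" "x \<le> p + t *\<^sub>R a" "- x \<le> p + t *\<^sub>R a"
      "q \<in> I" "0 \<le> s" "y \<le> q + s *\<^sub>R a" "- y \<le> q + s *\<^sub>R a"
      by (auto simp: adjoin_def)
    have "x + y \<le> (p + q) + (t + s) *\<^sub>R a" "- (x + y) \<le> (p + q) + (t + s) *\<^sub>R a"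
      using add_mono[OF *(3,7)] add_mono[OF *(4,8)] by (simp_all add: algebra_simps)
    then show "x + y \<in> adjoin I a"
      using * ideal_add[OF I] unfolding adjoin_def mem_Collect_eq
      by (intro bexI[of _ "p + q"] exI[of _ "t + s"]) auto
  next
    fix c x assume "x \<in> adjoin I a"
    then obtain p t where *: "p \<in> I" "0 \<le> t" "x \<le> p + t *\<^sub>R a" "- x \<le> p + t *\<^sub>R a"
      by (auto simp: adjoin_def)
    \<comment> \<open>Only nonnegative scalars preserve the order, so \<open>\<bar>c\<bar>\<close>
      is used first; its sign is then absorbed by the symmetry of the two bounds in \<open>x\<close>
      and \<open>- x\<close>.\<close>
    have "\<bar>c\<bar> *\<^sub>R x \<le> \<bar>c\<bar> *\<^sub>R p + (\<bar>c\<bar> * t) *\<^sub>R a" "- (\<bar>c\<bar> *\<^sub>R x) \<le> \<bar>c\<bar> *\<^sub>R p + (\<bar>c\<bar> * t) *\<^sub>R a"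
      using scaleR_left_mono[OF *(3), of "\<bar>c\<bar>"] scaleR_left_mono[OF *(4), of "\<bar>c\<bar>"]
      by (simp_all add: algebra_simps)
    then have "c *\<^sub>R x \<le> \<bar>c\<bar> *\<^sub>R p + (\<bar>c\<bar> * t) *\<^sub>R a" "- (c *\<^sub>R x) \<le> \<bar>c\<bar> *\<^sub>R p + (\<bar>c\<bar> * t) *\<^sub>R a"
      by (auto simp: abs_if split: if_splits)
    then show "c *\<^sub>R x \<in> adjoin I a"
      using * ideal_scaleR[OF I] unfolding adjoin_def mem_Collect_eq
      by (intro bexI[of _ "\<bar>c\<bar> *\<^sub>R p"] exI[of _ "\<bar>c\<bar> * t"]) auto
  qed
next
  fix x p assume "p \<in> adjoin I a" and x: "x \<le> modulus p" "- x \<le> modulus p"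
  then obtain q t where *: "q \<in> I" "0 \<le> t" "p \<le> q + t *\<^sub>R a" "- p \<le> q + t *\<^sub>R a"
    by (auto simp: adjoin_def)
  then have "modulus p \<le> q + t *\<^sub>R a"
    by (simp add: modulus_le_iff)
  with x * show "x \<in> adjoin I a"
    by (auto simp: adjoin_def intro: order_trans)
qed

lemma subset_adjoin:
  assumes "order_ideal I"
  shows "I \<subseteq> adjoin I a"
proof
  fix x assume "x \<in> I"
  then show "x \<in> adjoin I a"
    using modulus_mem_ideal_iff[OF assms] le_modulus
    unfolding adjoin_def mem_Collect_eq
    by (intro bexI[of _ "modulus x"] exI[of _ 0]) auto
qed

lemma mem_adjoin:
  assumes "order_ideal I" "0 \<le> a"
  shows "a \<in> adjoin I a"
proof -
  have "- a \<le> a"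
    using assms(2) by (simp add: order_trans[of "- a" 0 a])
  then show ?thesis
    using ideal_0[OF assms(1)] unfolding adjoin_def mem_Collect_eq
    by (intro bexI[of _ 0] exI[of _ 1]) auto
qed

lemma adjoin_subset:
  assumes J: "order_ideal J" "I \<subseteq> J" "a \<in> J"
  shows "adjoin I a \<subseteq> J"
proof
  fix x assume "x \<in> adjoin I a"
  then obtain p t where *: "p \<in> I" "x \<le> p + t *\<^sub>R a" "- x \<le> p + t *\<^sub>R a"
    by (auto simp: adjoin_def)
  then show "x \<in> J"
    using J by (intro mem_ideal_if_le[OF J(1) _ *(2,3)] ideal_add ideal_scaleR) auto
qed

section \<open>Prime ideals\<close>

definition prime_ideal :: "'a::{ordered_real_vector, lattice} set \<Rightarrow> bool" where
  "prime_ideal P \<longleftrightarrow>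
     order_ideal P \<and> (\<forall>a b. inf a b = 0 \<longrightarrow> a \<in> P \<or> b \<in> P)"

lemma prime_ideal_ideal: "prime_ideal P \<Longrightarrow> order_ideal P"
  by (simp add: prime_ideal_def)

lemma prime_ideal_infD:
  assumes "prime_ideal P" "inf a b \<in> P"
  shows "a \<in> P \<or> b \<in> P"
proof -
  have P: "order_ideal P" using assms by (simp add: prime_ideal_def)
  have "a - inf a b \<in> P \<or> b - inf a b \<in> P"
    using assms(1) inf_diff_inf_eq_0 unfolding prime_ideal_def by blast
  then show ?thesis
    using ideal_add[OF P _ assms(2)] by fastforce
qed

lemma inf_mem_ideal:
  assumes "order_ideal I" "0 \<le> a" "0 \<le> b" "a \<in> I \<or> b \<in> I"
  shows "inf a b \<in> I"
  using assms mem_ideal_if_nonneg_le[OF assms(1), of a "inf a b"]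
    mem_ideal_if_nonneg_le[OF assms(1), of b "inf a b"] by auto

text \<open>Positive elements of \<open>I\<close> and of \<open>J\<close> outside \<open>P\<close>
  would have their infimum in both ideals, hence in \<open>P\<close>, against primality.\<close>

lemma prime_ideal_Int:
  assumes "prime_ideal P" "order_ideal I" "order_ideal J" "I \<inter> J \<subseteq> P"
  shows "I \<subseteq> P \<or> J \<subseteq> P"
proof (rule ccontr)
  assume "\<not> (I \<subseteq> P \<or> J \<subseteq> P)"
  then obtain a b where ab: "0 \<le> a" "a \<in> I" "a \<notin> P" "0 \<le> b" "b \<in> J" "b \<notin> P"
    using not_subset_nonneg prime_ideal_ideal assms by metis
  then have "inf a b \<in> I \<inter> J"
    using inf_mem_ideal assms(2,3) by blast
  then show False
    using prime_ideal_infD[OF assms(1)] ab assms(4) by blast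
qed

text \<open>This is the source of the forest property. For positive \<open>a\<close> in
  \<open>I\<close> but not \<open>J\<close> and \<open>b\<close> in \<open>J\<close> but not
  \<open>I\<close>, the infimum lies in both ideals and one of the disjoint remainders lies in
  \<open>P\<close>; adding them back puts \<open>a\<close> into \<open>J\<close> or \<open>b\<close>
  into \<open>I\<close>.\<close>

lemma ideals_above_prime_comparable:
  assumes "prime_ideal P" "order_ideal I" "order_ideal J" "P \<subseteq> I" "P \<subseteq> J"
  shows "I \<subseteq> J \<or> J \<subseteq> I"
proof (rule ccontr)
  assume "\<not> (I \<subseteq> J \<or> J \<subseteq> I)"
  then obtain a b where ab: "0 \<le> a" "a \<in> I" "a \<notin> J" "0 \<le> b" "b \<in> J" "b \<notin> I"
    using not_subset_nonneg assms by metis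
  then have i: "inf a b \<in> I" "inf a b \<in> J"
    using inf_mem_ideal assms(2,3) by blast+
  have "a - inf a b \<in> P \<or> b - inf a b \<in> P"
    using assms(1) inf_diff_inf_eq_0 unfolding prime_ideal_def by blast
  then have "a - inf a b \<in> J \<or> b - inf a b \<in> I"
    using assms by blast
  then show False
    using ideal_add[OF assms(3) _ i(2), of "a - inf a b"] ideal_add[OF assms(2) _ i(1), of "b - inf a b"] ab
    by auto
qed

text \<open>Positive elements separate the ideals in both directions. Their infimum lies in both
  ideals, so removing it makes them disjoint and keeps them outside.\<close>

lemma incomparable_disjoint:
  assumes "order_ideal P" "order_ideal Q" "\<not> P \<subseteq> Q" "\<not> Q \<subseteq> P"
  obtains u v where "0 \<le> u" "0 \<le> v" "inf u v = 0" "u \<notin> P" "v \<notin> Q"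
proof -
  obtain a b where ab: "0 \<le> a" "a \<in> Q" "a \<notin> P" "0 \<le> b" "b \<in> P" "b \<notin> Q"
    using not_subset_nonneg assms by metis
  then have i: "inf a b \<in> P" "inf a b \<in> Q"
    using inf_mem_ideal assms(1,2) by blast+
  have "a - inf a b \<notin> P" "b - inf a b \<notin> Q"
    using ideal_add[OF assms(1) _ i(1), of "a - inf a b"] ideal_add[OF assms(2) _ i(2), of "b - inf a b"] ab
    by auto
  then show ?thesis
    using that[of "a - inf a b" "b - inf a b"] inf_diff_inf_eq_0[of a b] by simp
qed

section \<open>Regular ideals\<close>

text \<open>These are the values of Hahn's theory: \<open>P\<close> is maximal among the ideals
  avoiding \<open>w\<close>. Equivalently, the intersection of all strictly larger ideals is
  strictly larger than \<open>P\<close>.\<close>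

definition regular_ideal :: "'a::{ordered_real_vector, lattice} set \<Rightarrow> bool" where
  "regular_ideal P \<longleftrightarrow>
     order_ideal P \<and> (\<exists>w. w \<notin> P \<and> (\<forall>J. order_ideal J \<and> P \<subset> J \<longrightarrow> w \<in> J))"

lemma regular_ideal_ideal: "regular_ideal P \<Longrightarrow> order_ideal P"
  by (simp add: regular_ideal_def)

text \<open>If disjoint \<open>a\<close> and \<open>b\<close> were both outside \<open>P\<close>,
  the witness \<open>w\<close> would lie in both enlarged ideals, and the infimum of the two
  resulting bounds would already be an element of \<open>P\<close>.\<close>

lemma regular_ideal_prime:
  assumes "regular_ideal P"
  shows "prime_ideal P"
  unfolding prime_ideal_def
proof (intro conjI allI impI)
  show P: "order_ideal P" using assms by (simp add: regular_ideal_def)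
  fix a b :: 'a assume ab0: "inf a b = 0"
  then have ab: "0 \<le> a" "0 \<le> b"
    by (metis inf.cobounded1, metis inf.cobounded2)
  obtain w where w: "w \<notin> P" "\<And>J. order_ideal J \<Longrightarrow> P \<subset> J \<Longrightarrow> w \<in> J"
    using assms by (auto simp: regular_ideal_def)
  have *: "w \<in> adjoin P x" if "0 \<le> x" "x \<notin> P" for x
    using w(2)[OF order_ideal_adjoin[OF P]] subset_adjoin[OF P] mem_adjoin[OF P that(1)] that(2) by blast
  show "a \<in> P \<or> b \<in> P"
  proof (rule ccontr)
    assume "\<not> (a \<in> P \<or> b \<in> P)"
    then have "w \<in> adjoin P a" "w \<in> adjoin P b"
      using * ab by auto
    then obtain p t q s where pq: "p \<in> P" "0 \<le> t" "w \<le> p + t *\<^sub>R a" "- w \<le> p + t *\<^sub>R a"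
      "q \<in> P" "0 \<le> s" "w \<le> q + s *\<^sub>R b" "- w \<le> q + s *\<^sub>R b"
      by (auto simp: adjoin_def)
    \<comment> \<open>One \<open>m\<close> in \<open>P\<close> and one scalar \<open>k\<close> serve
      both bounds, so that translation and scaling can be pulled out of the infimum. Moduli appear
      because \<open>p\<close> and \<open>q\<close> may fail to be positive.\<close>
    define m where "m = modulus p + modulus q"
    define k where "k = max t s"
    have m: "m \<in> P"
      unfolding m_def using pq P by (intro ideal_add) (auto simp: modulus_mem_ideal_iff)
    have pm: "p \<le> m" "q \<le> m"
      using add_mono[OF le_modulus(1)[of p] modulus_nonneg[of q]]
        add_mono[OF modulus_nonneg[of p] le_modulus(1)[of q]]
      by (simp_all add: m_def)
    have *: "p + t *\<^sub>R a \<le> k *\<^sub>R a + m"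
      using add_mono[OF scaleR_right_mono[OF _ ab(1), of t k] pm(1)] by (simp add: k_def add.commute)
    have **: "q + s *\<^sub>R b \<le> k *\<^sub>R b + m"
      using add_mono[OF scaleR_right_mono[OF _ ab(2), of s k] pm(2)] by (simp add: k_def add.commute)
    have "inf (k *\<^sub>R a + m) (k *\<^sub>R b + m) = m"
      unfolding inf_add_right using scaleR_inf[of k a b] pq ab0 by (simp add: k_def le_max_iff_disj)
    then have "x \<le> m" if "x \<le> p + t *\<^sub>R a" "x \<le> q + s *\<^sub>R b" for x
      using inf_greatest[OF order_trans[OF that(1) *] order_trans[OF that(2) **]] by simp
    then have "w \<le> m" "- w \<le> m"
      using pq(3,4,7,8) by blast+
    then show False
      using mem_ideal_if_le[OF P m] w(1) by blast
  qed
qed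

section \<open>Maximum condition, existence of regular ideals, and covers\<close>

text \<open>Without a maximal member, iterating a choice of strictly larger members would give an
  increasing sequence that never becomes stationary.\<close>

lemma noetherian_maximal_ideal:
  fixes S :: "'a::{ordered_real_vector, lattice} set set"
  assumes "noetherian TYPE('a)" "S \<noteq> {}" "\<And>I. I \<in> S \<Longrightarrow> order_ideal I"
  shows "\<exists>M\<in>S. \<forall>I\<in>S. M \<subseteq> I \<longrightarrow> I = M"
proof (rule ccontr)
  assume "\<not> ?thesis"
  then have *: "\<exists>J. J \<in> S \<and> I \<subset> J" if "I \<in> S" for I
    using that by blast
  obtain I0 where "I0 \<in> S" using assms(2) by blast
  then obtain f :: "nat \<Rightarrow> 'a set" where f: "\<And>n. f n \<in> S" "\<And>n. f n \<subset> f (Suc n)"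
  proof -
    obtain g where g: "\<And>I. I \<in> S \<Longrightarrow> g I \<in> S \<and> I \<subset> g I"
      using * by metis
    have "(g ^^ n) I0 \<in> S" for n
      using \<open>I0 \<in> S\<close> g by (induction n) auto
    then show ?thesis
      using that[of "\<lambda>n. (g ^^ n) I0"] g by simp
  qed
  then have "incseq f" "\<And>n. order_ideal (f n)"
    using assms(3) by (auto intro!: incseq_SucI)
  then obtain k where "\<And>n. n \<ge> k \<Longrightarrow> f n = f k"
    using assms(1) unfolding noetherian_def by blast
  then show False
    using f(2)[of k] by (metis less_irrefl le_Suc_eq order_refl)
qed

lemma ex_regular_ideal:
  fixes I :: "'a::{ordered_real_vector, lattice} set"
  assumes "noetherian TYPE('a)" "order_ideal I" "w \<notin> I"
  obtains P where "regular_ideal P" "I \<subseteq> P" "w \<notin> P"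
    "\<And>J. order_ideal J \<Longrightarrow> P \<subset> J \<Longrightarrow> w \<in> J"
proof -
  define S where "S = {J. order_ideal J \<and> I \<subseteq> J \<and> w \<notin> J}"
  have "I \<in> S" using assms(2,3) by (simp add: S_def)
  then have "S \<noteq> {}" by blast
  then have "\<exists>M\<in>S. \<forall>J\<in>S. M \<subseteq> J \<longrightarrow> J = M"
    by (rule noetherian_maximal_ideal[OF assms(1)]) (simp add: S_def)
  then obtain M where M: "order_ideal M" "I \<subseteq> M" "w \<notin> M"
    "\<And>J. order_ideal J \<Longrightarrow> I \<subseteq> J \<Longrightarrow> w \<notin> J \<Longrightarrow> M \<subseteq> J \<Longrightarrow> J = M"
    by (auto simp: S_def)
  have "w \<in> J" if "order_ideal J" "M \<subset> J" for J
    using M(2) M(4)[of J] that by blast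
  then show ?thesis
    using that[of M] M(1-3) by (auto simp: regular_ideal_def)
qed

text \<open>For a regular ideal of a Noetherian vector lattice this is the least ideal strictly
  above it. Only regular ideals are intersected because they will be the points of the forest; an
  empty family yields the whole space.\<close>

definition cover :: "'a::{ordered_real_vector, lattice} set \<Rightarrow> 'a set" where
  "cover P = \<Inter>{Q. regular_ideal Q \<and> P \<subset> Q}"

lemma order_ideal_cover: "order_ideal (cover P)"
  unfolding cover_def by (rule order_ideal_Inter) (simp add: regular_ideal_def)

lemma subset_cover: "P \<subseteq> cover P"
  unfolding cover_def by blast

text \<open>Every element outside \<open>J\<close> is avoided by some regular ideal above
  \<open>J\<close>, and that ideal is one of those intersected in the cover.\<close>

lemma cover_subset:
  fixes P :: "'a::{ordered_real_vector, lattice} set"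
  assumes "noetherian TYPE('a)" "order_ideal J" "P \<subset> J"
  shows "cover P \<subseteq> J"
proof
  fix u assume u: "u \<in> cover P"
  show "u \<in> J"
  proof (rule ccontr)
    assume "u \<notin> J"
    then obtain Q where "regular_ideal Q" "J \<subseteq> Q" "u \<notin> Q"
      using ex_regular_ideal[OF assms(1,2)] by metis
    then show False
      using u assms(3) by (auto simp: cover_def)
  qed
qed

lemma cover_not_subset:
  assumes "regular_ideal P"
  shows "\<not> cover P \<subseteq> P"
proof -
  obtain w where "w \<notin> P" "\<And>J. order_ideal J \<Longrightarrow> P \<subset> J \<Longrightarrow> w \<in> J"
    using assms by (auto simp: regular_ideal_def)
  then show ?thesis
    unfolding cover_def using regular_ideal_ideal by blast
qed

text \<open>The quotient of \<^term>\<open>cover P\<close> by \<^term>\<open>P\<close> is totally ordered without proper nonzero ideals,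
  hence archimedean, hence one-dimensional; the coefficient is found as a Dedekind cut.\<close>

lemma cover_one_dim:
  fixes P :: "'a::{ordered_real_vector, lattice} set"
  assumes noeth: "noetherian TYPE('a)" and reg: "regular_ideal P"
    and e: "e \<in> cover P" "e \<notin> P" "0 \<le> e" and u: "u \<in> cover P"
  obtains c where "u - c *\<^sub>R e \<in> P"
proof -
  have P: "order_ideal P" and prime: "prime_ideal P"
    using reg regular_ideal_prime regular_ideal_ideal by auto
  have adj: "x \<in> adjoin P a" if "0 \<le> a" "a \<notin> P" "x \<in> cover P" for a x
    using cover_subset[OF noeth order_ideal_adjoin[OF P], of P a] subset_adjoin[OF P]
      mem_adjoin[OF P that(1)] that by blast
  \<comment> \<open>The lower half of the cut: the scalars \<open>t\<close> for which
    \<open>t *\<^sub>R e\<close> is at most \<open>u\<close> modulo \<open>P\<close>.\<close>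
  define A where "A = {t. \<exists>p\<in>P. t *\<^sub>R e \<le> u + p}"
  \<comment> \<open>Modulo \<open>P\<close>, multiples of \<open>e\<close> are ordered like their
    scalars: otherwise a positive multiple of \<open>e\<close> would be dominated by an element of
    \<open>P\<close>.\<close>
  have neg: "t \<le> s" if "p \<in> P" "t *\<^sub>R e \<le> s *\<^sub>R e + p" for t s p
  proof (rule ccontr)
    assume ts: "\<not> t \<le> s"
    have "(t - s) *\<^sub>R e \<in> P"
      using that e(3) ts
      by (intro mem_ideal_if_nonneg_le[OF P that(1)]) (auto simp: algebra_simps intro: scaleR_right_mono)
    then show False
      using ideal_scaleR_iff[OF P] ts e(2) by auto
  qed
  obtain p t where pt: "p \<in> P" "0 \<le> t" "u \<le> p + t *\<^sub>R e" "- u \<le> p + t *\<^sub>R e"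
    using adj[OF e(3,2) u] by (auto simp: adjoin_def)
  have "- t \<in> A"
    unfolding A_def using pt(1) add_right_mono[OF pt(4), of "u - t *\<^sub>R e"]
    by (auto intro!: bexI[of _ p] simp: add.commute)
  then have ne: "A \<noteq> {}" by blast
  have le: "s \<le> r" if "s \<in> A" "q \<in> P" "u \<le> r *\<^sub>R e + q" for s r q
  proof -
    obtain q' where q': "q' \<in> P" "s *\<^sub>R e \<le> u + q'"
      using \<open>s \<in> A\<close> unfolding A_def by blast
    then have "s *\<^sub>R e \<le> r *\<^sub>R e + (q + q')"
      using add_right_mono[OF that(3), of q'] by (auto simp: add.assoc intro: order_trans)
    then show ?thesis
      using neg ideal_add[OF P that(2) q'(1)] by blast
  qed
  have bdd: "bdd_above A"
    using le[of _ p t] pt by (auto intro!: bdd_aboveI[of _ t] simp: add.commute)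
  define c where "c = Sup A"
  define d where "d = u - c *\<^sub>R e"
  have "d \<in> P"
  proof (rule ccontr)
    assume d: "d \<notin> P"
    then have md: "modulus d \<notin> P" by (simp add: modulus_mem_ideal_iff[OF P])
    then obtain q m where q: "q \<in> P" "0 \<le> m" "e \<le> q + m *\<^sub>R modulus d"
      using adj[OF modulus_nonneg md e(1)] by (auto simp: adjoin_def)
    have m: "0 < m"
    proof (rule ccontr)
      assume "\<not> 0 < m"
      then have "e \<le> q" using q by auto
      then show False using mem_ideal_if_nonneg_le[OF P q(1) e(3)] e(2) by blast
    qed
    have e': "(1/m) *\<^sub>R e \<le> (1/m) *\<^sub>R q + modulus d"
      using scaleR_left_mono[OF q(3), of "1/m"] m by (simp add: algebra_simps)
    \<comment> \<open>These are twice the positive and negative parts of \<open>d\<close>. Whichever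
      lies in \<open>P\<close>, \<open>modulus d\<close> is congruent to \<open>- d\<close> or
      \<open>d\<close> modulo \<open>P\<close>, so \<open>u\<close> differs from
      \<open>c *\<^sub>R e\<close> by at least \<open>(1/m) *\<^sub>R e\<close> in one direction,
      which contradicts the choice of \<open>c\<close> as supremum.\<close>
    have "inf (d + modulus d) (- d + modulus d) = 0"
    proof -
      have "sup d (-d) + inf d (- d) = 0" using sup_add_inf[of d "- d"] by simp
      then show ?thesis
        using inf_add_right[of d "modulus d" "- d"] by (simp add: modulus_def add.commute)
    qed
    then consider "d + modulus d \<in> P" | "- d + modulus d \<in> P"
      using prime unfolding prime_ideal_def by blast
    then show False
    proof cases
      case 1
      have "u \<le> (c - 1/m) *\<^sub>R e + ((1/m) *\<^sub>R q + (d + modulus d))"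
        using e' by (simp add: d_def algebra_simps)
      moreover have "(1/m) *\<^sub>R q + (d + modulus d) \<in> P"
        by (rule ideal_add[OF P ideal_scaleR[OF P q(1)] 1])
      ultimately have "s \<le> c - 1/m" if "s \<in> A" for s
        using le[OF that] by blast
      then have "c \<le> c - 1/m"
        unfolding c_def using ne by (intro cSup_least)
      then show False using m by simp
    next
      case 2
      have "(c + 1/m) *\<^sub>R e \<le> u + ((1/m) *\<^sub>R q + (- d + modulus d))"
        using e' by (simp add: d_def algebra_simps)
      moreover have "(1/m) *\<^sub>R q + (- d + modulus d) \<in> P"
        by (rule ideal_add[OF P ideal_scaleR[OF P q(1)] 2])
      ultimately have "c + 1/m \<in> A"
        unfolding A_def by blast
      then have "c + 1/m \<le> c"
        unfolding c_def using bdd by (intro cSup_upper)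
      then show False using m by simp
    qed
  qed
  then show ?thesis
    using that by (simp add: d_def)
qed

text \<open>Take \<open>M\<close> maximal among the ideals below infinitely many members of
  \<open>A\<close>, and disjoint \<open>u\<close>, \<open>v\<close> separating two of these members.
  Each member above \<open>M\<close> contains \<open>u\<close> or \<open>v\<close>, but by
  maximality only finitely many contain a given positive element outside \<open>M\<close>.\<close>

lemma finite_prime_antichain:
  fixes A :: "'a::{ordered_real_vector, lattice} set set"
  assumes noeth: "noetherian TYPE('a)" and prime: "\<And>P. P \<in> A \<Longrightarrow> prime_ideal P"
    and anti: "\<And>P Q. P \<in> A \<Longrightarrow> Q \<in> A \<Longrightarrow> P \<subseteq> Q \<Longrightarrow> P = Q"
  shows "finite A"
proof (rule ccontr)
  assume inf: "infinite A"
  define S where "S = {I. order_ideal I \<and> infinite {P \<in> A. I \<subseteq> P}}"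
  have ideal: "order_ideal P" if "P \<in> A" for P
    using prime[OF that] by (rule prime_ideal_ideal)
  have "\<Inter>A \<in> S"
  proof -
    have "{P \<in> A. \<Inter>A \<subseteq> P} = A" by blast
    then show ?thesis
      using inf order_ideal_Inter[OF ideal] by (simp add: S_def)
  qed
  then have "S \<noteq> {}" by blast
  then have "\<exists>M\<in>S. \<forall>J\<in>S. M \<subseteq> J \<longrightarrow> J = M"
    by (rule noetherian_maximal_ideal[OF noeth]) (simp add: S_def)
  then obtain M where M: "M \<in> S" "\<And>I. I \<in> S \<Longrightarrow> M \<subseteq> I \<Longrightarrow> I = M"
    by blast
  define B where "B = {P \<in> A. M \<subseteq> P}"
  have B: "infinite B" "order_ideal M"
    using M(1) by (auto simp: S_def B_def)
  obtain P Q where PQ: "P \<in> B" "Q \<in> B" "P \<noteq> Q"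
    using B(1) by (metis finite.emptyI finite_insert finite_subset insertI1 subsetI)
  then have PQA: "P \<in> A" "Q \<in> A" "M \<subseteq> P" "M \<subseteq> Q" by (auto simp: B_def)
  obtain u v where uv: "0 \<le> u" "0 \<le> v" "inf u v = 0" "u \<notin> P" "v \<notin> Q"
    using incomparable_disjoint[OF ideal[OF PQA(1)] ideal[OF PQA(2)]] anti PQA PQ(3) by metis
  have no: "finite {R \<in> B. x \<in> R}" if "0 \<le> x" "x \<notin> M" for x
  proof (rule ccontr)
    assume "infinite {R \<in> B. x \<in> R}"
    moreover have "{R \<in> B. x \<in> R} \<subseteq> {R \<in> A. adjoin M x \<subseteq> R}"
      using adjoin_subset ideal by (auto simp: B_def)
    ultimately have "adjoin M x \<in> S"
      unfolding S_def mem_Collect_eq using order_ideal_adjoin[OF B(2)] infinite_super by blast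
    then show False
      using M(2) subset_adjoin[OF B(2)] mem_adjoin[OF B(2) that(1)] that(2) by blast
  qed
  have "B \<subseteq> {R \<in> B. u \<in> R} \<union> {R \<in> B. v \<in> R}"
    using prime uv(3) by (auto simp: B_def prime_ideal_def)
  moreover have "finite ({R \<in> B. u \<in> R} \<union> {R \<in> B. v \<in> R})"
    using no uv PQA by blast
  ultimately show False
    using B(1) finite_subset by blast
qed

text \<open>Among the families of regular ideals not below \<^term>\<open>P\<close> whose intersection lies in
  \<^term>\<open>P\<close>, one with maximal intersection would have a prime intersection; then all its members are
  comparable with \<^term>\<open>P\<close>, hence contain \<^term>\<open>cover P\<close>.\<close>

lemma Inter_not_subset_regular:
  fixes P :: "'a::{ordered_real_vector, lattice} set"
  assumes noeth: "noetherian TYPE('a)" and reg: "regular_ideal P"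
    and N: "\<And>Q. Q \<in> N \<Longrightarrow> regular_ideal Q \<and> \<not> Q \<subseteq> P"
  shows "\<not> \<Inter>N \<subseteq> P"
proof
  assume bad: "\<Inter>N \<subseteq> P"
  define S where "S = {\<Inter>L | L. L \<subseteq> N \<and> \<Inter>L \<subseteq> P}"
  have P: "order_ideal P" "prime_ideal P"
    using reg regular_ideal_prime regular_ideal_ideal by auto
  have ideal: "order_ideal (\<Inter>L)" if "L \<subseteq> N" for L
    using N that by (intro order_ideal_Inter) (auto simp: regular_ideal_def)
  have "\<Inter>N \<in> S"
    using bad by (auto simp: S_def)
  then have "S \<noteq> {}" by blast
  then have "\<exists>M\<in>S. \<forall>J\<in>S. M \<subseteq> J \<longrightarrow> J = M"
    by (rule noetherian_maximal_ideal[OF noeth]) (use ideal in \<open>auto simp: S_def\<close>)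
  then obtain M where M: "M \<in> S" "\<And>I. I \<in> S \<Longrightarrow> M \<subseteq> I \<Longrightarrow> I = M"
    by blast
  then obtain L where L: "L \<subseteq> N" "M = \<Inter>L" "M \<subseteq> P"
    by (auto simp: S_def)
  have MI: "order_ideal M" using ideal L by simp
  have "prime_ideal M"
  proof (rule ccontr)
    assume "\<not> prime_ideal M"
    then obtain a b where ab: "inf a b = 0" "a \<notin> M" "b \<notin> M"
      using MI by (auto simp: prime_ideal_def)
    define La where "La = {Q \<in> L. a \<in> Q}"
    define Lb where "Lb = {Q \<in> L. b \<in> Q}"
    \<comment> \<open>Every member of \<open>L\<close> is prime and so contains \<open>a\<close> or
      \<open>b\<close>. As \<open>P\<close> is prime, one half still has its intersection inside
      \<open>P\<close>, and that intersection is strictly larger than \<open>M\<close>.\<close>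
    have "L = La \<union> Lb"
      using ab(1) N L(1) regular_ideal_prime by (fastforce simp: La_def Lb_def prime_ideal_def)
    then have "\<Inter>La \<inter> \<Inter>Lb \<subseteq> P"
      using L(2,3) by (simp add: Inter_Un_distrib)
    moreover have sub: "La \<subseteq> N" "Lb \<subseteq> N" using L(1) by (auto simp: La_def Lb_def)
    ultimately have "\<Inter>La \<subseteq> P \<or> \<Inter>Lb \<subseteq> P"
      using prime_ideal_Int[OF P(2)] ideal by blast
    then have "\<Inter>La \<in> S \<or> \<Inter>Lb \<in> S"
      using sub by (auto simp: S_def)
    moreover have "M \<subseteq> \<Inter>La" "M \<subseteq> \<Inter>Lb" "a \<in> \<Inter>La" "b \<in> \<Inter>Lb"
      using L by (auto simp: La_def Lb_def)
    ultimately show False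
      using M(2) ab by blast
  qed
  \<comment> \<open>Both \<open>P\<close> and \<open>Q\<close> contain the prime ideal
    \<open>M\<close>, so they are comparable; since \<open>Q\<close> is not inside \<open>P\<close>,
    it is strictly larger.\<close>
  have "cover P \<subseteq> Q" if "Q \<in> L" for Q
  proof -
    have "regular_ideal Q" "\<not> Q \<subseteq> P" "M \<subseteq> Q"
      using that N L by auto
    then have "regular_ideal Q" "P \<subset> Q"
      using ideals_above_prime_comparable[OF \<open>prime_ideal M\<close> P(1), of Q] L(3)
        regular_ideal_ideal by blast+
    then show ?thesis by (auto simp: cover_def)
  qed
  then show False
    using L cover_not_subset[OF reg] by blast
qed

section \<open>Lexicographically ordered function spaces\<close>

lemma ex_minimal_below:
  assumes po: "partial_order_on X r" and wf: "well_founded_poset r X" and S: "S \<subseteq> X" "z \<in> S"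
  obtains y where "y \<in> minimal_elements r S" "(y, z) \<in> r"
proof -
  have "(z, z) \<in> r"
    using po S by (auto simp: partial_order_on_def preorder_on_def refl_on_def)
  then have "{y \<in> S. (y, z) \<in> r} \<noteq> {}" "{y \<in> S. (y, z) \<in> r} \<subseteq> X"
    using S by auto
  then obtain y where y: "y \<in> minimal_elements r {y \<in> S. (y, z) \<in> r}"
    using wf unfolding well_founded_poset_def by blast
  have "trans r"
    using po by (simp add: partial_order_on_def preorder_on_def)
  with y have "y \<in> minimal_elements r S" "(y, z) \<in> r"
    unfolding minimal_elements_def by (auto dest: transD)
  then show ?thesis by (rule that)
qed

lemma lex_space_iff:
  assumes "well_founded_poset r X"
  shows "f \<in> lex_space r X \<longleftrightarrow> supp f \<subseteq> X"
  using assms unfolding lex_space_def well_founded_poset_def by auto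

lemma lex_cone_iff:
  assumes "well_founded_poset r X"
  shows "f \<in> lex_cone r X \<longleftrightarrow> supp f \<subseteq> X \<and> (\<forall>x\<in>minimal_elements r (supp f). f x > 0)"
  by (simp add: lex_cone_def lex_space_iff[OF assms])

lemma lex_cone_antisym:
  assumes wf: "well_founded_poset r X" and f: "f \<in> lex_cone r X" "(\<lambda>x. - f x) \<in> lex_cone r X"
  shows "f = (\<lambda>_. 0)"
proof -
  have "supp (\<lambda>x. - f x) = supp f" by (simp add: supp_def)
  then have "minimal_elements r (supp f) = {}"
    using f unfolding lex_cone_iff[OF wf] by fastforce
  then have "supp f = {}"
    using wf f unfolding well_founded_poset_def lex_cone_iff[OF wf] by blast
  then show ?thesis by (auto simp: supp_def)
qed

lemma minimal_elements_suppD: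
  assumes "z \<in> minimal_elements r (supp f)"
  shows "f z \<noteq> 0" "(y, z) \<in> r \<Longrightarrow> y \<noteq> z \<Longrightarrow> f y = 0"
  using assms by (auto simp: minimal_elements_def supp_def)

text \<open>Minimality in the support is a local matter: it involves only the values at
  \<open>z\<close> and below.\<close>

lemma minimal_elements_supp_cong:
  assumes "z \<in> minimal_elements r (supp f)" "(z, z) \<in> r" "\<And>y. (y, z) \<in> r \<Longrightarrow> g y = f y"
  shows "z \<in> minimal_elements r (supp g)"
  using assms by (auto simp: minimal_elements_def supp_def)

lemma finite_minimal_elements:
  assumes "finite_width r X" "S \<subseteq> X"
  shows "finite (minimal_elements r S)"
proof -
  have "pairwise (\<lambda>x y. (x, y) \<notin> r \<and> (y, x) \<notin> r) (minimal_elements r S)"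
    by (auto simp: pairwise_def minimal_elements_def)
  moreover have "minimal_elements r S \<subseteq> X"
    using assms(2) by (auto simp: minimal_elements_def)
  ultimately show ?thesis
    using assms(1) by (simp add: finite_width_def)
qed

text \<open>The order is recovered from suprema, since \<open>0 \<le> w\<close> means
  \<open>sup 0 w = w\<close>; antisymmetry of the lexicographic order turns two inequalities between
  images into equality.\<close>

lemma lattice_isomorphism_nonneg_iff:
  fixes T :: "'a::{ordered_real_vector, lattice} \<Rightarrow> 'b \<Rightarrow> real"
  assumes wf: "well_founded_poset r X" and iso: "lattice_isomorphism r X F T"
  shows "0 \<le> w \<longleftrightarrow> T w \<in> lex_cone r X"
proof -
  have sup: "is_lex_sup r X (T 0) (T w) (T (sup 0 w))"
    and inj: "inj T" and T0: "T 0 = (\<lambda>_. 0)"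
  proof -
    have "T (0 *\<^sub>R 0) = (\<lambda>x. 0 * T 0 x)"
      using iso unfolding lattice_isomorphism_def by blast
    then show "T 0 = (\<lambda>_. 0)" by simp
  qed (use iso in \<open>auto simp: lattice_isomorphism_def bij_betw_def\<close>)
  have w: "T w \<in> lex_space r X" and refl: "lex_le r X (T w) (T w)"
  proof -
    have "is_lex_sup r X (T w) (T w) (T w)"
      using iso unfolding lattice_isomorphism_def by (metis sup.idem)
    then show "T w \<in> lex_space r X" "lex_le r X (T w) (T w)"
      by (auto simp: is_lex_sup_def)
  qed
  show ?thesis
  proof
    assume "0 \<le> w"
    then have "sup 0 w = w" by (simp add: sup.absorb2)
    then show "T w \<in> lex_cone r X"
      using sup T0 by (simp add: is_lex_sup_def lex_le_def)
  next
    assume "T w \<in> lex_cone r X"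
    then have "lex_le r X (T 0) (T w)"
      by (simp add: T0 lex_le_def)
    then have "lex_le r X (T (sup 0 w)) (T w)" "lex_le r X (T w) (T (sup 0 w))"
      using sup w refl unfolding is_lex_sup_def by blast+
    then have "(\<lambda>x. T w x - T (sup 0 w) x) = (\<lambda>_. 0)"
      using lex_cone_antisym[OF wf] unfolding lex_le_def by fastforce
    then have "T w = T (sup 0 w)"
      by (metis diff_eq_diff_eq diff_self ext)
    then have "w = sup 0 w"
      using inj by (simp add: inj_def)
    then show "0 \<le> w"
      by (metis sup.cobounded1)
  qed
qed

section \<open>From a representation to the chain condition\<close>

text \<open>Two facts carry the proof: an ideal containing \<open>v\<close> contains the preimage
  \<open>e x\<close> of the indicator of every minimal support point \<open>x\<close> of
  \<open>T v\<close> (\<open>e_mem\<close>), and it contains \<open>v\<close> as soon as it contains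
  all of these (\<open>mem\<close>).\<close>

lemma lex_representable_imp_noetherian:
  fixes r :: "('b \<times> 'b) set"
  assumes po: "partial_order_on X r" and wf: "well_founded_poset r X" and fw: "finite_width r X"
    and rep: "lex_representable TYPE('a::{ordered_real_vector, lattice}) r X"
  shows "noetherian TYPE('a)"
proof -
  obtain F and T :: "'a \<Rightarrow> 'b \<Rightarrow> real" where Lex: "Lex r X \<subseteq> F"
    and F: "F \<subseteq> lex_space r X" and iso: "lattice_isomorphism r X F T"
    using rep by (auto simp: lex_representable_def vector_sublattice_def)
  have bij: "bij_betw T UNIV F" and T_add: "T (u + v) x = T u x + T v x"
    and T_scale: "T (c *\<^sub>R u) x = c * T u x" for u v c x
    using iso unfolding lattice_isomorphism_def by (auto simp: fun_eq_iff)
  have T_0: "T 0 x = 0" for x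
    using T_scale[of 0 0 x] by simp
  have T_minus: "T (- u) x = - T u x" for u x
    using T_scale[of "-1" u x] by simp
  have T_diff: "T (u - v) x = T u x - T v x" for u v x
    using T_add[of u "- v" x] by (simp add: T_minus)
  have T_sum: "T (sum h A) x = (\<Sum>a\<in>A. T (h a) x)" for A :: "'b set" and h x
    by (induction A rule: infinite_finite_induct) (simp_all add: T_0 T_add)
  have supp_T: "supp (T u) \<subseteq> X" for u
    using bij F lex_space_iff[OF wf] by (auto simp: bij_betw_def)
  note nonneg_iff = lattice_isomorphism_nonneg_iff[OF wf iso]
  have nonnegI: "0 \<le> w" if "\<And>z. z \<in> minimal_elements r (supp (T w)) \<Longrightarrow> 0 < T w z" for w
    using that supp_T nonneg_iff lex_cone_iff[OF wf] by blast
  have nonnegD: "0 < T w z" if "0 \<le> w" "z \<in> minimal_elements r (supp (T w))" for w z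
    using that nonneg_iff lex_cone_iff[OF wf] by blast
  have below: "\<exists>y\<in>minimal_elements r (supp (T w)). (y, z) \<in> r" if "T w z \<noteq> 0" for w z
    using ex_minimal_below[OF po wf supp_T[of w], of z] that by (auto simp: supp_def)
  have antisym: "x = y" if "(x, y) \<in> r" "(y, x) \<in> r" for x y
    using po that by (auto simp: partial_order_on_def antisym_def)
  have refl: "(x, x) \<in> r" if "x \<in> X" for x
    using po that by (auto simp: partial_order_on_def preorder_on_def refl_on_def)
  have "\<exists>u. T u = (\<lambda>y. if y = x then 1 else 0)" if "x \<in> X" for x
  proof -
    have "supp (\<lambda>y. if y = x then 1 else 0 :: real) = {x}"
      by (auto simp: supp_def)
    then have "(\<lambda>y. if y = x then 1 else 0) \<in> Lex r X"
      using that by (simp add: Lex_def lex_space_iff[OF wf])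
    then have "(\<lambda>y. if y = x then 1 else 0) \<in> range T"
      using Lex bij by (auto simp: bij_betw_def)
    then show ?thesis
      by (metis imageE)
  qed
  then obtain e where e: "\<And>x. x \<in> X \<Longrightarrow> T (e x) = (\<lambda>y. if y = x then 1 else 0)"
    by metis
  have e_nonneg: "0 \<le> e x" if "x \<in> X" for x
  proof (rule nonnegI)
    fix z assume "z \<in> minimal_elements r (supp (T (e x)))"
    then show "0 < T (e x) z"
      using minimal_elements_suppD(1)[of z r "T (e x)"] e[OF that] by (simp split: if_splits)
  qed
  have e_mono: "e y \<le> e x" if "(x, y) \<in> r" "x \<in> X" "y \<in> X" for x y
  proof -
    have "0 \<le> e x - e y"
    proof (rule nonnegI)
      fix z assume z: "z \<in> minimal_elements r (supp (T (e x - e y)))"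
      \<comment> \<open>The lower point has the larger indicator: the difference is 1 at
        \<open>x\<close>, the only possible minimal point of its support.\<close>
      have eq: "T (e x - e y) = (\<lambda>z. (if z = x then 1 else 0) - (if z = y then 1 else 0))"
        using e that by (simp add: T_diff fun_eq_iff)
      show "0 < T (e x - e y) z"
        using minimal_elements_suppD(1)[OF z] minimal_elements_suppD(2)[OF z, of x] that(1)
        unfolding eq by (auto split: if_splits)
    qed
    then show ?thesis by simp
  qed
  have e_mem: "e x \<in> I" if I: "order_ideal I" "v \<in> I" and x: "x \<in> minimal_elements r (supp (T v))" for I v x
  proof -
    \<comment> \<open>The numerator 2 leaves a value of at least 1 at \<open>x\<close> after the
      indicator is subtracted.\<close>
    define c where "c = 2 / \<bar>T v x\<bar>"
    have Tx: "T v x \<noteq> 0" using x by (auto simp: minimal_elements_def supp_def)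
    then have xX: "x \<in> X" using supp_T[of v] by (auto simp: supp_def)
    have c: "0 < c" "c * \<bar>T v x\<bar> = 2" using Tx by (auto simp: c_def)
    \<comment> \<open>If \<open>T (modulus v)\<close> vanishes strictly below \<open>x\<close>, so
      do the images of the positive elements \<open>modulus v - v\<close> and
      \<open>modulus v + v\<close>; their values at \<open>x\<close> therefore cannot be
      negative.\<close>
    have dom: "\<bar>T v x\<bar> \<le> T (modulus v) x" if h: "\<And>y. (y, x) \<in> r \<Longrightarrow> y \<noteq> x \<Longrightarrow> T (modulus v) y = 0"
    proof -
      have *: "0 \<le> T (modulus v - w) x" if "0 \<le> modulus v - w" "w = v \<or> w = - v" for w
      proof (rule ccontr)
        assume neg: "\<not> 0 \<le> T (modulus v - w) x"
        have "T v y = 0" if "(y, x) \<in> r" "y \<noteq> x" for y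
          using minimal_elements_suppD(2)[OF x that] .
        then have "T (modulus v - w) y = 0" if "(y, x) \<in> r" "y \<noteq> x" for y
          using h that \<open>w = v \<or> w = - v\<close> by (auto simp: T_diff T_minus)
        then have "x \<in> minimal_elements r (supp (T (modulus v - w)))"
          using neg by (auto simp: minimal_elements_def supp_def)
        then show False
          using nonnegD[OF that(1)] neg by fastforce
      qed
      show ?thesis
        using *[of v] *[of "- v"] le_modulus[of v] diff_ge_0_iff_ge[of "modulus v"]
        unfolding T_diff T_minus by fastforce
    qed
    have "0 \<le> c *\<^sub>R modulus v - e x"
    proof (rule nonnegI)
      fix z assume z: "z \<in> minimal_elements r (supp (T (c *\<^sub>R modulus v - e x)))"
      have eq: "T (c *\<^sub>R modulus v - e x) y = c * T (modulus v) y - (if y = x then 1 else 0)" for y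
        using e[OF xX] by (simp add: T_diff T_scale)
      have ge: "c * T (modulus v) x \<ge> 2" if "\<And>y. (y, x) \<in> r \<Longrightarrow> y \<noteq> x \<Longrightarrow> T (modulus v) y = 0"
        using mult_left_mono[OF dom[OF that], of c] c by simp
      have vanish: "T (modulus v) y = 0"
        if "x \<in> minimal_elements r (supp (T (modulus v)))" "(y, x) \<in> r" "y \<noteq> x" for y
        using minimal_elements_suppD(2) that by metis
      show "0 < T (c *\<^sub>R modulus v - e x) z"
      proof (cases "z = x")
        case True
        have "T (modulus v) y = 0" if "(y, x) \<in> r" "y \<noteq> x" for y
        proof (rule ccontr)
          assume "T (modulus v) y \<noteq> 0"
          then have "y \<in> supp (T (c *\<^sub>R modulus v - e x))"
            using that(2) c(1) by (simp add: supp_def eq)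
          then show False
            using minimal_elements_suppD(2)[OF z] that True by (auto simp: supp_def)
        qed
        then show ?thesis using ge True by (force simp: eq)
      next
        case False
        then have Tz: "T (modulus v) z \<noteq> 0"
          using minimal_elements_suppD(1)[OF z] c(1) by (auto simp: eq)
        obtain y where y: "y \<in> minimal_elements r (supp (T (modulus v)))" "(y, z) \<in> r"
          using below[OF Tz] by blast
        \<comment> \<open>Otherwise the difference vanishes at \<open>y\<close>, which forces
          \<open>y = x\<close> and the value 1 for \<open>c * T (modulus v) x\<close>, against the
          lower bound 2.\<close>
        have "y = z"
        proof (rule ccontr)
          assume "y \<noteq> z"
          then have 0: "T (c *\<^sub>R modulus v - e x) y = 0"
            using minimal_elements_suppD(2)[OF z y(2)] by blast
          moreover have "T (modulus v) y \<noteq> 0"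
            using minimal_elements_suppD(1)[OF y(1)] .
          ultimately have "y = x"
            using c(1) by (auto simp: eq split: if_splits)
          then have "c * T (modulus v) x \<ge> 2"
            using ge vanish y(1) by blast
          then show False
            using 0 \<open>y = x\<close> by (simp add: eq)
        qed
        then show ?thesis
          using nonnegD[OF modulus_nonneg] y(1) c(1) False by (auto simp: eq)
      qed
    qed
    then show ?thesis
      using I e_nonneg[OF xX] by (intro mem_ideal_if_nonneg_le[OF I(1) _ e_nonneg[OF xX], of "c *\<^sub>R modulus v"])
        (auto simp: modulus_mem_ideal_iff[OF I(1)] intro: ideal_scaleR)
  qed
  have mem: "v \<in> I" if I: "order_ideal I" and v: "\<And>x. x \<in> minimal_elements r (supp (T v)) \<Longrightarrow> e x \<in> I" for I v
  proof -
    define M where "M = minimal_elements r (supp (T v))"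
    have M: "finite M" "M \<subseteq> X" "M \<subseteq> supp (T v)"
      unfolding M_def using finite_minimal_elements[OF fw supp_T] supp_T by (auto simp: minimal_elements_def)
    \<comment> \<open>The sum bounds every \<open>\<bar>T v m\<bar>\<close>, and the summand 1 makes
      the bound strict, so that \<open>p - v\<close> and \<open>p + v\<close> are positive at all
      points of \<open>M\<close>.\<close>
    define c where "c = (\<Sum>m\<in>M. \<bar>T v m\<bar>) + 1"
    define p where "p = (\<Sum>m\<in>M. c *\<^sub>R e m)"
    have c: "\<bar>T v m\<bar> < c" if "m \<in> M" for m
      using member_le_sum[OF that, of "\<lambda>m. \<bar>T v m\<bar>"] M(1) by (simp add: c_def)
    have Tp: "T p z = (if z \<in> M then c else 0)" for z
    proof -
      have "T p z = (\<Sum>m\<in>M. c * (if z = m then 1 else 0))"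
        unfolding p_def T_sum using e M(2) by (intro sum.cong) (auto simp: T_scale)
      also have "\<dots> = (if z \<in> M then c else 0)"
        using M(1) by (simp add: sum_distrib_left[symmetric])
      finally show ?thesis .
    qed
    have "0 \<le> p - w" if w: "w = v \<or> w = - v" for w
    proof (rule nonnegI)
      have eq: "T (p - w) y = (if y \<in> M then c else 0) - T w y" for y
        by (simp add: T_diff Tp)
      have pos: "0 < T (p - w) m" if "m \<in> M" for m
        using c[OF that] that w by (auto simp: eq T_minus)
      fix z assume z: "z \<in> minimal_elements r (supp (T (p - w)))"
      then have "T v z \<noteq> 0"
        using minimal_elements_suppD(1)[OF z] M(3) w by (auto simp: supp_def eq T_minus split: if_splits)
      then obtain m where m: "m \<in> M" "(m, z) \<in> r"
        using below M_def by blast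
      then have "m = z"
        using minimal_elements_suppD(2)[OF z m(2)] pos[OF m(1)] by auto
      then show "0 < T (p - w) z"
        using pos m by simp
    qed
    from this[of v] this[of "- v"] have "v \<le> p" "- v \<le> p"
      unfolding diff_ge_0_iff_ge by blast+
    moreover have "p \<in> I"
      unfolding p_def using v I by (intro subspace_sum ideal_scaleR) (auto simp: M_def order_ideal_def)
    ultimately show ?thesis
      using mem_ideal_if_le[OF I] by blast
  qed
  show ?thesis
    unfolding noetherian_def
  proof (intro allI impI)
    fix I :: "nat \<Rightarrow> 'a set"
    assume I: "(\<forall>n. order_ideal (I n)) \<and> incseq I"
    then have ideal: "order_ideal (I n)" and inc: "m \<le> n \<Longrightarrow> I m \<subseteq> I n" for m n
      by (auto simp: incseq_def)
    \<comment> \<open>The finitely many minimal points of \<open>U\<close> enter the sequence at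
      finitely many stages; after the last of them, \<open>e_mono\<close> and solidity supply the
      indicators of all points of \<open>U\<close>.\<close>
    define U where "U = {x \<in> X. \<exists>n. e x \<in> I n}"
    have UX: "U \<subseteq> X" by (auto simp: U_def)
    define M where "M = minimal_elements r U"
    have M: "finite M" "M \<subseteq> U"
      unfolding M_def using finite_minimal_elements[OF fw UX] by (auto simp: minimal_elements_def)
    then have "\<forall>m\<in>M. \<exists>n. e m \<in> I n" by (auto simp: U_def)
    then obtain N where N: "\<And>m. m \<in> M \<Longrightarrow> e m \<in> I (N m)" by metis
    \<comment> \<open>The inserted 0 keeps the maximum meaningful when \<open>M\<close> is
      empty.\<close>
    define k where "k = Max (insert 0 (N ` M))"
    have k: "e m \<in> I k" if "m \<in> M" for m
      using N[OF that] inc[of "N m" k] M(1) that by (auto simp: k_def)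
    have "I n \<subseteq> I k" for n
    proof
      fix v assume v: "v \<in> I n"
      show "v \<in> I k"
      proof (rule mem[OF ideal])
        fix x assume x: "x \<in> minimal_elements r (supp (T v))"
        then have xX: "x \<in> X" using supp_T[of v] by (auto simp: minimal_elements_def)
        then have "x \<in> U"
          using e_mem[OF ideal v x] by (auto simp: U_def)
        then obtain m where m: "m \<in> M" "(m, x) \<in> r"
          using ex_minimal_below[OF po wf UX] M_def by metis
        then show "e x \<in> I k"
          using mem_ideal_if_nonneg_le[OF ideal k[OF m(1)] e_nonneg[OF xX]] e_mono[OF m(2)] M UX xX
          by blast
      qed
    qed
    then show "\<exists>k. \<forall>n\<ge>k. I n = I k"
      using inc by blast
  qed
qed

section \<open>The embedding of a Noetherian vector lattice\<close>

text \<open>The regular ideals, with reversed inclusion, form the forest. The regular ideal \<^term>\<open>pr x\<close> is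
  named by a positive element \<^term>\<open>x\<close> whose indicator function will represent it.\<close>

locale regular_indexing =
  fixes X :: "'a::{ordered_real_vector, lattice} set" and pr :: "'a \<Rightarrow> 'a set"
  assumes noeth: "noetherian TYPE('a)"
    and regular: "x \<in> X \<Longrightarrow> regular_ideal (pr x)"
    and surj: "regular_ideal P \<Longrightarrow> \<exists>x\<in>X. pr x = P"
    and inj: "x \<in> X \<Longrightarrow> y \<in> X \<Longrightarrow> pr x = pr y \<Longrightarrow> x = y"
    and nonneg: "x \<in> X \<Longrightarrow> 0 \<le> x"
    and not_mem: "x \<in> X \<Longrightarrow> x \<notin> pr x"
    and mem: "x \<in> X \<Longrightarrow> y \<in> X \<Longrightarrow> \<not> pr y \<subseteq> pr x \<Longrightarrow> x \<in> pr y"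
begin

definition le :: "('a \<times> 'a) set" where
  "le = {(x, y). x \<in> X \<and> y \<in> X \<and> pr y \<subseteq> pr x}"

lemma ideal: "x \<in> X \<Longrightarrow> order_ideal (pr x)"
  by (simp add: regular regular_ideal_ideal)

lemma prime: "x \<in> X \<Longrightarrow> prime_ideal (pr x)"
  by (simp add: regular regular_ideal_prime)

lemma le_refl: "x \<in> X \<Longrightarrow> (x, x) \<in> le"
  by (simp add: le_def)

lemma partial_order_le: "partial_order_on X le"
  by (auto simp: partial_order_on_def preorder_on_def refl_on_def trans_def antisym_def le_def intro: inj)

lemma well_founded_le: "well_founded_poset le X"
  unfolding well_founded_poset_def
proof (intro allI impI)
  fix S assume S: "S \<subseteq> X" "S \<noteq> {}"
  have "\<exists>M\<in>pr ` S. \<forall>J\<in>pr ` S. M \<subseteq> J \<longrightarrow> J = M"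
    by (rule noetherian_maximal_ideal[OF noeth]) (use S ideal in auto)
  then obtain m where "m \<in> S" "\<And>y. y \<in> S \<Longrightarrow> pr m \<subseteq> pr y \<Longrightarrow> pr y = pr m"
    by auto
  then have "m \<in> minimal_elements le S"
    using S inj by (auto simp: minimal_elements_def le_def)
  then show "minimal_elements le S \<noteq> {}" by blast
qed

text \<open>The points below \<open>x\<close> are regular ideals containing the prime ideal
  \<open>pr x\<close>, hence comparable; antichains of points are antichains of prime ideals, hence
  finite.\<close>

lemma wf_forest_le: "wf_forest_of_finite_width le X"
  unfolding wf_forest_of_finite_width_def
proof (intro conjI)
  show "forest_poset le X"
    unfolding forest_poset_def total_on_def
    using ideals_above_prime_comparable prime ideal by (auto simp: le_def) blast
  show "finite_width le X"
    unfolding finite_width_def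
  proof (intro allI impI)
    fix A assume A: "A \<subseteq> X" "pairwise (\<lambda>x y. (x, y) \<notin> le \<and> (y, x) \<notin> le) A"
    have "finite (pr ` A)"
    proof (rule finite_prime_antichain[OF noeth])
      show "prime_ideal P" if "P \<in> pr ` A" for P
        using that prime A(1) by auto
      show "P = Q" if "P \<in> pr ` A" "Q \<in> pr ` A" "P \<subseteq> Q" for P Q
      proof -
        obtain x y where xy: "x \<in> A" "y \<in> A" "P = pr x" "Q = pr y"
          using \<open>P \<in> pr ` A\<close> \<open>Q \<in> pr ` A\<close> by blast
        then have "(y, x) \<in> le"
          using \<open>P \<subseteq> Q\<close> A(1) by (auto simp: le_def)
        then have "x = y"
          using A(2) xy by (auto simp: pairwise_def)
        then show ?thesis using xy by simp
      qed
    qed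
    moreover have "inj_on pr A"
      using A(1) inj by (intro inj_onI) blast
    ultimately show "finite A"
      by (rule finite_imageD)
  qed
qed (rule partial_order_le well_founded_le)+

section \<open>Linear independence of the indices and the coordinate functionals\<close>

text \<open>Let \<open>m\<close> be minimal among the indices below \<open>x\<close> with nonzero
  coefficient. All other terms lie in \<open>pr m\<close>, and so does the whole sum because
  \<open>pr x \<subseteq> pr m\<close>; this would force \<open>m\<close> into
  \<open>pr m\<close>.\<close>

lemma sum_mem_imp_coeff_eq_0:
  assumes t: "finite t" "t \<subseteq> X" and x: "x \<in> X" and s: "(\<Sum>a\<in>t. c a *\<^sub>R a) \<in> pr x"
    and a: "a \<in> t" "(a, x) \<in> le"
  shows "c a = 0"
proof (rule ccontr)
  assume "c a \<noteq> 0"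
  define S where "S = {b \<in> t. (b, x) \<in> le \<and> c b \<noteq> 0}"
  have "a \<in> S" "S \<subseteq> X"
    using a t \<open>c a \<noteq> 0\<close> by (auto simp: S_def)
  then obtain m where m: "m \<in> minimal_elements le S"
    using well_founded_le unfolding well_founded_poset_def by blast
  then have mS: "m \<in> t" "m \<in> X" "(m, x) \<in> le" "c m \<noteq> 0"
    using t by (auto simp: S_def minimal_elements_def)
  have rest: "c b *\<^sub>R b \<in> pr m" if b: "b \<in> t - {m}" for b
  proof (cases "c b = 0")
    case True
    then show ?thesis using ideal_0[OF ideal[OF mS(2)]] by simp
  next
    case False
    have "(b, m) \<notin> le"
    proof
      assume bm: "(b, m) \<in> le"
      then have "(b, x) \<in> le" using mS(3) by (auto simp: le_def)
      then show False
        using m b bm False by (auto simp: S_def minimal_elements_def)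
    qed
    then have "b \<in> pr m"
      using b t mS by (intro mem) (auto simp: le_def)
    then show ?thesis by (rule ideal_scaleR[OF ideal[OF mS(2)]])
  qed
  have "(\<Sum>b\<in>t - {m}. c b *\<^sub>R b) \<in> pr m"
    using rest ideal[OF mS(2)] by (intro subspace_sum) (auto simp: order_ideal_def)
  moreover have "(\<Sum>a\<in>t. c a *\<^sub>R a) \<in> pr m"
    using s mS by (auto simp: le_def)
  ultimately have "c m *\<^sub>R m \<in> pr m"
    using ideal_diff[OF ideal[OF mS(2)]] sum.remove[OF t(1) mS(1), of "\<lambda>a. c a *\<^sub>R a"]
    by (metis add_diff_cancel_right')
  then show False
    using ideal_scaleR_iff[OF ideal[OF mS(2)] mS(4)] not_mem[OF mS(2)] by blast
qed

lemma ex_coordinate: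
  assumes x: "x \<in> X"
  shows "\<exists>f :: 'a \<Rightarrow> real. linear f \<and> (\<forall>u\<in>pr x. f u = 0) \<and> (\<forall>y\<in>X - {x}. f y = 0) \<and> f x = 1"
proof -
  define S where "S = pr x \<union> (X - {x})"
  have "x \<notin> span S"
  proof
    assume "x \<in> span S"
    moreover have "span (pr x) = pr x"
      using ideal[OF x] by (simp add: order_ideal_def)
    ultimately obtain p q where pq: "x = p + q" "p \<in> pr x" "q \<in> span (X - {x})"
      unfolding S_def span_Un by auto
    then obtain t c where t: "finite t" "t \<subseteq> X - {x}" "q = (\<Sum>a\<in>t. c a *\<^sub>R a)"
      by (auto simp: span_explicit)
    \<comment> \<open>The relation is rewritten as a combination with coefficient 1 at
      \<open>x\<close> whose value \<open>x - q = p\<close> lies in \<open>pr x\<close>.\<close>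
    define d where "d = (\<lambda>a. if a = x then 1 else - c a)"
    have "(\<Sum>a\<in>t. d a *\<^sub>R a) = (\<Sum>a\<in>t. - (c a *\<^sub>R a))"
      using t(2) by (intro sum.cong) (auto simp: d_def)
    then have "(\<Sum>a\<in>insert x t. d a *\<^sub>R a) = x - q"
      using t by (subst sum.insert) (auto simp: d_def sum_negf)
    then have "(\<Sum>a\<in>insert x t. d a *\<^sub>R a) \<in> pr x"
      using pq by (metis add_diff_cancel_right')
    then have "d x = 0"
      using t x le_refl[OF x] by (intro sum_mem_imp_coeff_eq_0[of "insert x t" x d x]) auto
    then show False by (simp add: d_def)
  qed
  \<comment> \<open>A basis of the span of \<open>S\<close> stays independent when \<open>x\<close>
    is added, so a functional can be prescribed as 0 on it and 1 at \<open>x\<close>.\<close>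
  obtain B where B: "B \<subseteq> S" "independent B" "S \<subseteq> span B"
    by (rule maximal_independent_subset)
  then have "span B = span S"
    by (metis span_mono span_span subset_antisym span_minimal subspace_span)
  then have "independent (insert x B)"
    using B \<open>x \<notin> span S\<close> by (simp add: independent_insertI)
  then obtain f :: "'a \<Rightarrow> real" where f: "linear f" "\<forall>b\<in>insert x B. f b = (if b = x then 1 else 0)"
    using linear_independent_extend[of "insert x B" "\<lambda>b. if b = x then 1 else 0"] by blast
  have "x \<notin> B"
    using \<open>x \<notin> span S\<close> \<open>span B = span S\<close> span_base by metis
  then have "f u = 0" if "u \<in> S" for u
    using linear_eq_0_on_span[OF f(1), of B u] f(2) B(3) that \<open>x \<notin> B\<close> by (metis insertCI subsetD)
  then show ?thesis
    using f by (intro exI[of _ f]) (auto simp: S_def)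
qed

definition coord :: "'a \<Rightarrow> 'a \<Rightarrow> real" where
  "coord x = (SOME f. linear f \<and> (\<forall>u\<in>pr x. f u = 0) \<and> (\<forall>y\<in>X - {x}. f y = 0) \<and> f x = 1)"

definition T :: "'a \<Rightarrow> 'a \<Rightarrow> real" where
  "T u x = (if x \<in> X then coord x u else 0)"

lemma coord:
  assumes "x \<in> X"
  shows linear_coord: "linear (coord x)"
    and coord_pr: "u \<in> pr x \<Longrightarrow> coord x u = 0"
    and coord_other: "y \<in> X \<Longrightarrow> y \<noteq> x \<Longrightarrow> coord x y = 0"
    and coord_self: "coord x x = 1"
  using someI_ex[OF ex_coordinate[OF assms]] unfolding coord_def[symmetric] by auto

lemma T_add: "T (u + v) x = T u x + T v x"
  and T_diff: "T (u - v) x = T u x - T v x"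
  and T_minus: "T (- u) x = - T u x"
  and T_scaleR: "T (c *\<^sub>R u) x = c * T u x"
  and T_sum: "T (sum h A) x = (\<Sum>a\<in>A. T (h a) x)"
  using linear_coord[of x]
  by (auto simp: T_def linear_add linear_diff linear_neg linear_scale linear_sum)

lemma T_zero: "T 0 x = 0"
  using T_scaleR[of 0 0 x] by simp

lemma T_X: "y \<in> X \<Longrightarrow> T y x = (if x = y then 1 else 0)"
  by (auto simp: T_def coord_self coord_other)

lemma supp_T: "supp (T u) \<subseteq> X"
  by (auto simp: supp_def T_def split: if_splits)

lemma T_pr: "u \<in> pr x \<Longrightarrow> (y, x) \<in> le \<Longrightarrow> T u y = 0"
  by (auto simp: T_def le_def coord_pr)

section \<open>Covers and minimal points of supports\<close>

lemma mem_cover: "x \<in> X \<Longrightarrow> x \<in> cover (pr x)"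
  unfolding cover_def using mem surj by blast

text \<open>The quotient of the cover by \<open>pr x\<close> is spanned by the class of
  \<open>x\<close>, and the functional \<open>coord x\<close> reads off the coefficient because it
  kills \<open>pr x\<close> and is 1 at \<open>x\<close>.\<close>

lemma diff_coord_mem:
  assumes x: "x \<in> X" and u: "u \<in> cover (pr x)"
  shows "u - T u x *\<^sub>R x \<in> pr x"
proof -
  obtain c where c: "u - c *\<^sub>R x \<in> pr x"
    using cover_one_dim[OF noeth regular mem_cover not_mem nonneg u] x by metis
  then have "T (u - c *\<^sub>R x) x = 0"
    using T_pr le_refl[OF x] by blast
  then have "T u x = c"
    using T_X[OF x] by (simp add: T_diff T_scaleR)
  with c show ?thesis by simp
qed

lemma T_eq_0_cover_iff:
  assumes "x \<in> X" "u \<in> cover (pr x)"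
  shows "T u x = 0 \<longleftrightarrow> u \<in> pr x"
  using diff_coord_mem[OF assms] T_pr[of u x x] le_refl[OF assms(1)] by auto

lemma T_cover: "u \<in> cover (pr x) \<Longrightarrow> (y, x) \<in> le \<Longrightarrow> y \<noteq> x \<Longrightarrow> T u y = 0"
  using T_pr[of u y y] inj regular unfolding cover_def le_def by blast

text \<open>If \<open>u\<close> were outside some regular \<open>Q\<close> strictly above
  \<open>pr x\<close>, a value of \<open>u\<close> containing \<open>Q\<close> would be an index
  strictly below \<open>x\<close> at which the coordinate of \<open>u\<close> is nonzero.\<close>

lemma cover_if_T_eq_0_below:
  assumes x: "x \<in> X" and 0: "\<And>y. (y, x) \<in> le \<Longrightarrow> y \<noteq> x \<Longrightarrow> T u y = 0"
  shows "u \<in> cover (pr x)"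
proof (rule ccontr)
  assume "u \<notin> cover (pr x)"
  then obtain Q where Q: "regular_ideal Q" "pr x \<subset> Q" "u \<notin> Q"
    by (auto simp: cover_def)
  obtain P where P: "regular_ideal P" "Q \<subseteq> P" "u \<notin> P"
    "\<And>J. order_ideal J \<Longrightarrow> P \<subset> J \<Longrightarrow> u \<in> J"
    using ex_regular_ideal[OF noeth regular_ideal_ideal[OF Q(1)] Q(3)] by metis
  obtain y where y: "y \<in> X" "pr y = P" using surj[OF P(1)] by blast
  have "u \<in> cover (pr y)"
    using P(4) y(2) regular_ideal_ideal by (auto simp: cover_def)
  moreover have "T u y = 0"
    using Q(2) P(2) x y by (intro 0) (auto simp: le_def)
  ultimately show False
    using T_eq_0_cover_iff y P(3) by blast
qed

text \<open>Together with \<open>minimal_supp_TI\<close> this identifies the minimal support points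
  of \<open>T u\<close> with the values of \<open>u\<close>: the indices whose cover contains
  \<open>u\<close> while the ideal itself does not.\<close>

lemma minimal_supp_TD:
  assumes "x \<in> minimal_elements le (supp (T u))"
  shows "x \<in> X" "T u x \<noteq> 0" "u \<in> cover (pr x)"
proof -
  show x: "x \<in> X" "T u x \<noteq> 0"
    using assms supp_T by (auto simp: minimal_elements_def supp_def)
  show "u \<in> cover (pr x)"
    using assms x by (intro cover_if_T_eq_0_below) (auto simp: minimal_elements_def supp_def)
qed

lemma minimal_supp_TI:
  assumes "x \<in> X" "u \<in> cover (pr x)" "u \<notin> pr x"
  shows "x \<in> minimal_elements le (supp (T u))"
proof -
  have "T u x \<noteq> 0"
    using assms T_eq_0_cover_iff by blast
  moreover have "y = x" if "T u y \<noteq> 0" "(y, x) \<in> le" for y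
    using T_cover[OF assms(2)] that by blast
  ultimately show ?thesis
    by (auto simp: minimal_elements_def supp_def)
qed

lemma ex_index:
  assumes "u \<noteq> 0"
  obtains x where "x \<in> X" "u \<in> cover (pr x)" "u \<notin> pr x"
proof -
  have "order_ideal {0 :: 'a}"
    by (rule order_idealI) (auto simp: subspace_def modulus_def intro: antisym)
  then obtain P where P: "regular_ideal P" "u \<notin> P" "\<And>J. order_ideal J \<Longrightarrow> P \<subset> J \<Longrightarrow> u \<in> J"
    using ex_regular_ideal[OF noeth, of "{0}" u] assms by (metis singletonD)
  then obtain x where "x \<in> X" "pr x = P" using surj by blast
  moreover have "u \<in> cover P"
    using P(3) regular_ideal_ideal by (auto simp: cover_def)
  ultimately show ?thesis
    using that P(2) by blast
qed

section \<open>The embedding preserves and reflects the order\<close>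

text \<open>Modulo \<open>pr x\<close>, \<open>u\<close> is \<open>T u x\<close> times
  \<open>x\<close>. With a negative coefficient, a positive multiple of \<open>x\<close> would be
  dominated by an element of \<open>pr x\<close>.\<close>

lemma T_pos_at_minimal:
  assumes u: "0 \<le> u" and x: "x \<in> minimal_elements le (supp (T u))"
  shows "0 < T u x"
proof (rule ccontr)
  note x' = minimal_supp_TD[OF x]
  assume "\<not> 0 < T u x"
  then have neg: "T u x < 0" using x'(2) by simp
  define p where "p = u - T u x *\<^sub>R x"
  have p: "p \<in> pr x"
    unfolding p_def using diff_coord_mem x' by blast
  have "(- T u x) *\<^sub>R x \<le> p"
    using u by (simp add: p_def)
  moreover have "0 \<le> (- T u x) *\<^sub>R x"
    using neg nonneg[OF x'(1)] by (intro scaleR_nonneg_nonneg) auto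
  ultimately have "(- T u x) *\<^sub>R x \<in> pr x"
    using mem_ideal_if_nonneg_le[OF ideal[OF x'(1)] p] by blast
  then show False
    using ideal_scaleR_iff[OF ideal[OF x'(1)], of "- T u x" x] neg not_mem[OF x'(1)] by simp
qed

lemma pos_neg_parts:
  fixes w :: 'a
  shows "w = sup w 0 - sup (- w) 0" "inf (sup w 0) (sup (- w) 0) = 0"
proof -
  have "sup 0 w = sup (- w) 0 + w"
    using sup_add_right[of "- w" w 0] by simp
  then have "sup w 0 = sup (- w) 0 + w"
    by (simp add: sup.commute)
  then have *: "sup (- w) 0 = - inf w 0"
    using sup_add_inf[of w 0] by (simp add: eq_neg_iff_add_eq_0 add.assoc add.left_commute)
  show "w = sup w 0 - sup (- w) 0"
    using sup_add_inf[of w 0] by (simp add: *)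
  have "sup w 0 = w - inf w 0"
    using sup_add_inf[of w 0] by (simp add: algebra_simps)
  then show "inf (sup w 0) (sup (- w) 0) = 0"
    using inf_diff_inf_eq_0[of w 0] by (simp add: *)
qed

text \<open>For the converse, a nonzero negative part \<open>n\<close> of \<open>u\<close> has a
  value \<open>pr x\<close>, which contains the positive part \<open>q\<close> by primality. So
  \<open>u\<close> agrees with \<open>- n\<close> modulo \<open>pr x\<close>, and \<open>x\<close>
  is a minimal support point with negative coordinate.\<close>

lemma T_mem_lex_cone_iff: "T u \<in> lex_cone le X \<longleftrightarrow> 0 \<le> u"
proof
  assume "0 \<le> u"
  then show "T u \<in> lex_cone le X"
    using supp_T T_pos_at_minimal by (simp add: lex_cone_iff[OF well_founded_le])
next
  assume cone: "T u \<in> lex_cone le X"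
  define q n where "q = sup u 0" and "n = sup (- u) 0"
  have qn: "u = q - n" "inf q n = 0" "0 \<le> q" "0 \<le> n"
    unfolding q_def n_def using pos_neg_parts[of u] by auto
  have "n = 0"
  proof (rule ccontr)
    assume "n \<noteq> 0"
    then obtain x where x: "x \<in> X" "n \<in> cover (pr x)" "n \<notin> pr x"
      using ex_index by blast
    have q: "q \<in> pr x"
      using prime[OF x(1)] qn(2) x(3) by (auto simp: prime_ideal_def)
    then have "u \<in> cover (pr x)"
      using x(2) qn(1) subset_cover ideal_diff[OF order_ideal_cover] by blast
    moreover have "u \<notin> pr x"
      using q x(3) qn(1) ideal_diff[OF ideal[OF x(1)], of q u] by auto
    ultimately have "0 < T u x"
      using cone minimal_supp_TI[OF x(1)] by (auto simp: lex_cone_iff[OF well_founded_le])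
    moreover have "T u x = - T n x"
      using T_pr[OF q le_refl[OF x(1)]] qn(1) by (simp add: T_diff)
    moreover have "0 < T n x"
      using T_pos_at_minimal[OF qn(4)] minimal_supp_TI[OF x] by blast
    ultimately show False by simp
  qed
  then show "0 \<le> u" using qn by simp
qed

lemma inj_T: "inj T"
proof (rule injI)
  fix u v assume "T u = T v"
  then have "T (u - v) = T 0" "T (v - u) = T 0"
    by (simp_all add: fun_eq_iff T_diff T_zero)
  then have "0 \<le> u - v" "0 \<le> v - u"
    using T_mem_lex_cone_iff by (metis order_refl)+
  then show "u = v" by (simp add: order_antisym)
qed

section \<open>Suprema, infima and the range of the embedding\<close>

lemma lex_le_T_iff: "lex_le le X (T u) (T v) \<longleftrightarrow> u \<le> v"
proof -
  have "(\<lambda>x. T v x - T u x) = T (v - u)" by (simp add: fun_eq_iff T_diff)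
  then show ?thesis by (simp add: lex_le_def T_mem_lex_cone_iff)
qed

lemma T_mem_lex_space: "T u \<in> lex_space le X"
  by (simp add: lex_space_iff[OF well_founded_le] supp_T)

text \<open>At a point, one of the two disjoint parts of \<^term>\<open>u - v\<close> has vanishing coordinates there and
  below; hence the supremum locally coincides with \<^term>\<open>T u\<close> or \<^term>\<open>T v\<close>.\<close>

lemma T_sup: "is_lex_sup le X (T u) (T v) (T (sup u v))"
  unfolding is_lex_sup_def
proof (intro conjI ballI impI)
  fix k assume k: "k \<in> lex_space le X" and ub: "lex_le le X (T u) k \<and> lex_le le X (T v) k"
  define q n where "q = sup (u - v) 0" and "n = sup (- (u - v)) 0"
  have qn: "u - v = q - n" "inf q n = 0"
    unfolding q_def n_def using pos_neg_parts[of "u - v"] by auto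
  have "sup u v = v + q"
    using sup_add_right[of "u - v" v 0] by (simp add: q_def add.commute)
  moreover have "v + q = u + n"
    using qn(1) by (metis add.commute add_diff_eq diff_eq_eq)
  ultimately have eq: "sup u v = v + q" "sup u v = u + n"
    by simp_all
  \<comment> \<open>The bound \<open>k\<close> may lie outside the range of \<open>T\<close>, so the
    comparison is made pointwise: where \<open>p\<close> vanishes at \<open>z\<close> and below,
    \<open>sup u v\<close> can be replaced by \<open>w\<close>, which \<open>k\<close>
    dominates.\<close>
  have pos: "0 < k z - T (sup u v) z"
    if z: "z \<in> minimal_elements le (supp (\<lambda>x. k x - T (sup u v) x))"
      and zX: "z \<in> X" and w: "lex_le le X (T w) k" and p: "sup u v = w + p" "p \<in> pr z" for z w p
  proof -
    have same: "T (sup u v) y = T w y" if "(y, z) \<in> le" for y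
      using T_pr[OF p(2) that] p(1) by (simp add: T_add)
    have "z \<in> minimal_elements le (supp (\<lambda>x. k x - T w x))"
      using z le_refl[OF zX] by (rule minimal_elements_supp_cong) (simp add: same)
    then show ?thesis
      using w same[OF le_refl[OF zX]] by (simp add: lex_le_def lex_cone_iff[OF well_founded_le])
  qed
  have "supp (\<lambda>x. k x - T (sup u v) x) \<subseteq> supp k \<union> supp (T (sup u v))"
    by (auto simp: supp_def)
  then have sub: "supp (\<lambda>x. k x - T (sup u v) x) \<subseteq> X"
    using k supp_T[of "sup u v"] by (auto simp: lex_space_iff[OF well_founded_le])
  have "0 < k z - T (sup u v) z"
    if z: "z \<in> minimal_elements le (supp (\<lambda>x. k x - T (sup u v) x))" for z
  proof -
    have zX: "z \<in> X" using z sub by (auto simp: minimal_elements_def)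
    then have "q \<in> pr z \<or> n \<in> pr z"
      using prime qn(2) by (auto simp: prime_ideal_def)
    then show ?thesis
      using pos[OF z zX] eq ub by blast
  qed
  then show "lex_le le X (T (sup u v)) k"
    using sub by (simp add: lex_le_def lex_cone_iff[OF well_founded_le])
qed (simp_all add: lex_le_T_iff T_mem_lex_space)

text \<open>The reflection of \<open>k\<close> to \<open>T u + T v - k\<close> turns lower bounds
  into upper bounds, and \<open>sup u v + inf u v = u + v\<close>.\<close>

lemma T_inf: "is_lex_inf le X (T u) (T v) (T (inf u v))"
  unfolding is_lex_inf_def
proof (intro conjI ballI impI)
  fix k assume k: "k \<in> lex_space le X" and lb: "lex_le le X k (T u) \<and> lex_le le X k (T v)"
  define k' where "k' x = T u x + T v x - k x" for x
  have "supp k' \<subseteq> supp k \<union> supp (T u) \<union> supp (T v)"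
    by (auto simp: k'_def supp_def)
  then have "supp k' \<subseteq> X"
    using k supp_T[of u] supp_T[of v] by (auto simp: lex_space_iff[OF well_founded_le])
  moreover have "lex_le le X (T u) k'" "lex_le le X (T v) k'"
    using lb by (simp_all add: lex_le_def k'_def)
  ultimately have "lex_le le X (T (sup u v)) k'"
    using T_sup[of u v] by (simp add: is_lex_sup_def lex_space_iff[OF well_founded_le])
  moreover have "T u x + T v x = T (sup u v) x + T (inf u v) x" for x
    by (simp add: T_add[symmetric] sup_add_inf)
  ultimately show "lex_le le X k (T (inf u v))"
    by (simp add: lex_le_def k'_def algebra_simps)
qed (simp_all add: lex_le_T_iff T_mem_lex_space)

lemma Lex_subset_range_T: "Lex le X \<subseteq> range T"
proof
  fix f assume "f \<in> Lex le X"
  then have f: "finite (supp f)" "supp f \<subseteq> X"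
    by (auto simp: Lex_def lex_space_iff[OF well_founded_le])
  have "T (\<Sum>x\<in>supp f. f x *\<^sub>R x) z = f z" for z
  proof -
    have "T (\<Sum>x\<in>supp f. f x *\<^sub>R x) z = (\<Sum>x\<in>supp f. if z = x then f x else 0)"
      unfolding T_sum using f(2) by (intro sum.cong) (auto simp: T_scaleR T_X)
    also have "\<dots> = f z"
      using f(1) by (auto simp: supp_def)
    finally show ?thesis .
  qed
  then have "f = T (\<Sum>x\<in>supp f. f x *\<^sub>R x)" by (simp add: fun_eq_iff)
  then show "f \<in> range T" by blast
qed

lemma lex_representable: "lex_representable TYPE('a) le X"
  unfolding lex_representable_def
proof (intro exI conjI)
  have "(\<lambda>_. 0) = T 0" "(\<lambda>x. T u x + T v x) = T (u + v)" "(\<lambda>x. c * T u x) = T (c *\<^sub>R u)" for u v c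
    by (simp_all add: fun_eq_iff T_add T_scaleR T_zero)
  moreover have "\<exists>h\<in>range T. is_lex_sup le X f g h" "\<exists>h\<in>range T. is_lex_inf le X f g h"
    if fg: "f \<in> range T" "g \<in> range T" for f g
  proof -
    obtain u v where "f = T u" "g = T v"
      using fg by blast
    then show "\<exists>h\<in>range T. is_lex_sup le X f g h" "\<exists>h\<in>range T. is_lex_inf le X f g h"
      using T_sup[of u v] T_inf[of u v] by auto
  qed
  ultimately show "vector_sublattice le X (range T)"
    using T_mem_lex_space unfolding vector_sublattice_def by auto
  show "lattice_isomorphism le X (range T) T"
    using inj_T T_sup T_inf
    by (auto simp: lattice_isomorphism_def bij_betw_def T_add T_scaleR fun_eq_iff)
qed (rule Lex_subset_range_T)

end

lemma noetherian_imp_representable: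
  assumes noeth: "noetherian TYPE('a::{ordered_real_vector, lattice})"
  shows "\<exists>(r :: ('a \<times> 'a) set) X. wf_forest_of_finite_width r X \<and> lex_representable TYPE('a) r X"
proof -
  define R where "R = {P :: 'a set. regular_ideal P}"
  have "\<exists>e. 0 \<le> e \<and> e \<notin> P \<and> (\<forall>Q\<in>R. \<not> Q \<subseteq> P \<longrightarrow> e \<in> Q)" if "P \<in> R" for P
  proof -
    \<comment> \<open>Any positive element of \<open>J\<close> outside \<open>P\<close> can serve as
      the index of \<open>P\<close>.\<close>
    define J where "J = \<Inter>{Q \<in> R. \<not> Q \<subseteq> P}"
    have "order_ideal J" "order_ideal P"
      using that by (auto simp: J_def R_def regular_ideal_ideal intro!: order_ideal_Inter)
    moreover have "\<not> J \<subseteq> P"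
      unfolding J_def using that by (intro Inter_not_subset_regular[OF noeth]) (auto simp: R_def)
    ultimately obtain e where "0 \<le> e" "e \<in> J" "e \<notin> P"
      by (rule not_subset_nonneg)
    then show ?thesis by (auto simp: J_def)
  qed
  then obtain e where e: "\<And>P. P \<in> R \<Longrightarrow> 0 \<le> e P" "\<And>P. P \<in> R \<Longrightarrow> e P \<notin> P"
    "\<And>P Q. P \<in> R \<Longrightarrow> Q \<in> R \<Longrightarrow> \<not> Q \<subseteq> P \<Longrightarrow> e P \<in> Q"
    by metis
  have "inj_on e R"
  proof (rule inj_onI)
    fix P Q assume PQ: "P \<in> R" "Q \<in> R" "e P = e Q"
    \<comment> \<open>If \<open>Q\<close> were not inside \<open>P\<close>, then \<open>e P\<close>
      would lie in \<open>Q\<close>, although it equals \<open>e Q\<close>; the other inclusion is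
      symmetric. Hence the forest can live on a subset of the lattice itself.\<close>
    then have "Q \<subseteq> P" "P \<subseteq> Q" using e by metis+
    then show "P = Q" by blast
  qed
  then have inv: "inv_into R e (e P) = P" if "P \<in> R" for P
    using that by simp
  interpret regular_indexing "e ` R" "inv_into R e"
  proof
    fix x y assume "x \<in> e ` R" "y \<in> e ` R" and xy: "\<not> inv_into R e y \<subseteq> inv_into R e x"
    then obtain P Q where "P \<in> R" "Q \<in> R" "x = e P" "y = e Q"
      by blast
    with xy show "x \<in> inv_into R e y" using e(3)[of P Q] inv by simp
  qed (use noeth e(1,2) inv in \<open>auto simp: R_def\<close>)
  show ?thesis
    using wf_forest_le lex_representable by blast
qed

theorem theorem6p10:
  shows "(noetherian TYPE('a::{ordered_real_vector, lattice}) \<longleftrightarrow>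
            (\<exists>(r :: ('a \<times> 'a) set) X.
               wf_forest_of_finite_width r X \<and> lex_representable TYPE('a) r X)) \<and>
         (\<forall>(r :: ('b \<times> 'b) set) X.
            wf_forest_of_finite_width r X \<and> lex_representable TYPE('a) r X
            \<longrightarrow> noetherian TYPE('a))"
proof (intro conjI iffI allI impI)
  show "\<exists>(r :: ('a \<times> 'a) set) X. wf_forest_of_finite_width r X \<and> lex_representable TYPE('a) r X"
    if "noetherian TYPE('a)"
    using that by (rule noetherian_imp_representable)
qed (auto simp: wf_forest_of_finite_width_def intro: lex_representable_imp_noetherian)

end
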